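(* Let $\gamma>3$. Let $D$ be a nonnegative integer-valued random variable such that $\mathbb{P}(D\ge k)=O(k^{1-\gamma})$ (for integers $k\ge1$) and $$\nu:=\frac{\mathbb{E}\,D(D-1)}{\mathbb{E}\,D}<1 .$$ Let $D_1,D_2,\dots$ be i.i.d. copies of $D$, condition on $\sum_{i=1}^n D_i$ being even, and let $G_n$ be the random multigraph $G^*(n,(D_i)_1^n)$ defined by the configuration model (see context). Then, as $n\to\infty$, $$|\mathcal{C}_1(G_n)|=\frac{\Delta(G_n)}{1-\nu}+o_p\bigl(n^{1/(\gamma-1)}\bigr).$$
   Context: Configuration model: given nonnegative integers $(d_i)_1^n$ with $\sum_{i=1}^n d_i$ even, take a set of $d_i$ half-edges for each vertex $i\in\{1,\dots,n\}$ and pair all the half-edges by a uniformly random perfect matching; each pair of half-edges is joined to form an edge. The resulting random multigraph (loops and multiple edges allowed, a loop contributing $2$ to the degree) is $G^*(n,(d_i)_1^n)$. In $G^*(n,(D_i)_1^n)$ the sequence $(D_i)_1^n$ is random (i.i.d. conditioned on even sum) and, given it, the pairing is uniformly random. Only those $n$ with $\mathbb{P}(\sum_{i=1}^n D_i\text{ even})>0$ are considered. $\Delta(G_n)=\max_{i\le n}D_i$ is the maximum degree of $G_n$, $\mathcal{C}_1(G_n)$ is the largest component of $G_n$ (any choice if there is a tie), and $|\mathcal{C}_1(G_n)|$ is its number of vertices. If $D=0$ almost surely, $\nu$ is interpreted as $0$. $X_n=o_p(a_n)$ means $\mathbb{P}(|X_n|>\varepsilon a_n)\to0$ as $n\to\infty$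 for every $\varepsilon>0$. *)

theory Defs
  imports
    "HOL-Probability.Probability"
    "HOL-Library.Landau_Symbols"
    "HOL-Library.Disjoint_Sets"
begin

text \<open>An edge is the size-two multiset of its endpoints, so that a loop at \<open>v\<close> is \<open>{#v, v#}\<close>;
  parallel edges are repeated members of the multiset of edges.\<close>

record 'v multigraph =
  verts :: "'v set"
  edges :: "'v multiset multiset"

text \<open>A loop at \<open>v\<close> contributes 2, because \<open>count {#v, v#} v = 2\<close>.\<close>

definition vertex_degree :: "'v multigraph \<Rightarrow> 'v \<Rightarrow> nat" where
  "vertex_degree G v = (\<Sum>e\<in>#edges G. count e v)"

definition max_degree :: "'v multigraph \<Rightarrow> nat" where
  "max_degree G = Max (vertex_degree G ` verts G)"

definition adj :: "'v multigraph \<Rightarrow> ('v \<times> 'v) set" where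
  "adj G = {(u, v). {#u, v#} \<in># edges G}"

definition graph_components :: "'v multigraph \<Rightarrow> 'v set set" where
  "graph_components G = (\<lambda>v. {u \<in> verts G. (v, u) \<in> (adj G)\<^sup>*}) ` verts G"

definition largest_component :: "'v multigraph \<Rightarrow> 'v set" where
  "largest_component G = (ARG_MAX card C. C \<in> graph_components G)"

lemma card_largest_component:
  assumes "finite (verts G)" "verts G \<noteq> {}"
  shows "largest_component G \<in> graph_components G"
    and "card (largest_component G) = Max (card ` graph_components G)"
proof -
  have fin: "finite (graph_components G)" and ne: "graph_components G \<noteq> {}"
    using assms by (auto simp: graph_components_def)
  then obtain C where C: "C \<in> graph_components G" by blast
  have b: "\<forall>C. C \<in> graph_components G \<longrightarrow> card C < Suc (Max (card ` graph_components G))"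
    using fin by (auto simp: less_Suc_eq_le)
  show mem: "largest_component G \<in> graph_components G"
    unfolding largest_component_def by (rule arg_max_natI[OF C b])
  have le: "card C' \<le> card (largest_component G)" if "C' \<in> graph_components G" for C'
    unfolding largest_component_def by (rule arg_max_nat_le[OF that b])
  show "card (largest_component G) = Max (card ` graph_components G)"
    by (rule Max_eqI[symmetric]) (use fin mem le in auto)
qed

definition half_edges :: "nat \<Rightarrow> (nat \<Rightarrow> nat) \<Rightarrow> (nat \<times> nat) set" where
  "half_edges n d = (SIGMA i:{1..n}. {..<d i})"

definition perfect_matchings :: "'a set \<Rightarrow> 'a set set set" where
  "perfect_matchings H = {M. partition_on H M \<and> (\<forall>e\<in>M. card e = 2)}"

definition multigraph_of_matching :: "nat \<Rightarrow> (nat \<times> nat) set set \<Rightarrow> nat multigraph" where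
  "multigraph_of_matching n M =
     \<lparr>verts = {1..n}, edges = {#{#fst h. h \<in># mset_set e#}. e \<in># mset_set M#}\<rparr>"

text \<open>This is \<open>G\<^sup>*(n, d)\<close>, meaningful when \<open>d 1 + \<dots> + d n\<close> is even; by the lemmas below the set of
  matchings is then finite and nonempty, as \<^const>\<open>pmf_of_set\<close> requires.\<close>

definition configuration_model :: "nat \<Rightarrow> (nat \<Rightarrow> nat) \<Rightarrow> nat multigraph pmf" where
  "configuration_model n d =
     map_pmf (multigraph_of_matching n) (pmf_of_set (perfect_matchings (half_edges n d)))"

text \<open>The value 0 outside the index set is the irrelevant default required by \<^const>\<open>Pi_pmf\<close>.\<close>

definition iid_degrees :: "nat pmf \<Rightarrow> nat \<Rightarrow> (nat \<Rightarrow> nat) pmf" where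
  "iid_degrees D n = Pi_pmf {1..n} 0 (\<lambda>_. D)"

definition even_sum :: "nat \<Rightarrow> (nat \<Rightarrow> nat) set" where
  "even_sum n = {d. even (\<Sum>i=1..n. d i)}"

definition admissible :: "nat pmf \<Rightarrow> nat set" where
  "admissible D = {n. measure_pmf.prob (iid_degrees D n) (even_sum n) > 0}"

text \<open>\<^const>\<open>cond_pmf\<close> is meaningful for \<open>n \<in> admissible D\<close> only.\<close>

definition random_multigraph :: "nat pmf \<Rightarrow> nat \<Rightarrow> nat multigraph pmf" where
  "random_multigraph D n =
     bind_pmf (cond_pmf (iid_degrees D n) (even_sum n)) (configuration_model n)"

text \<open>If \<open>D = 0\<close> almost surely, this is \<open>0 / 0 = 0\<close>.  Both expectations are meaningful when \<open>D\<close> has a finite second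
  moment, which \<open>P(D \<ge> k) = O(k powr (1 - \<gamma>))\<close> with \<open>\<gamma> > 3\<close> ensures.\<close>

definition nu :: "nat pmf \<Rightarrow> real" where
  "nu D = measure_pmf.expectation D (\<lambda>k. real k * (real k - 1)) / measure_pmf.expectation D real"

text \<open>\<open>X\<^sub>n = o\<^sub>p(a\<^sub>n)\<close> as \<open>n \<rightarrow> \<infinity>\<close> through the index set \<open>N\<close>, where \<open>X\<^sub>n\<close> is defined on the probability
  space \<open>P n\<close>.\<close>

definition small_o_p ::
  "nat set \<Rightarrow> (nat \<Rightarrow> 'a pmf) \<Rightarrow> (nat \<Rightarrow> 'a \<Rightarrow> real) \<Rightarrow> (nat \<Rightarrow> real) \<Rightarrow> bool" where
  "small_o_p N P X a \<longleftrightarrow>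
     (\<forall>\<epsilon>>0. ((\<lambda>n. measure_pmf.prob (P n) {\<omega>. \<bar>X n \<omega>\<bar> > \<epsilon> * a n}) \<longlongrightarrow> 0)
              (inf sequentially (principal N)))"

lemma finite_half_edges: "finite (half_edges n d)"
  by (simp add: half_edges_def)

lemma card_half_edges: "card (half_edges n d) = (\<Sum>i=1..n. d i)"
  by (simp add: half_edges_def)

lemma finite_perfect_matchings:
  assumes "finite H"
  shows "finite (perfect_matchings H)"
  by (rule finite_subset[of _ "Pow (Pow H)"])
     (use assms in \<open>auto simp: perfect_matchings_def partition_on_def\<close>)

lemma perfect_matchings_nonempty:
  assumes "finite H" "even (card H)"
  shows "perfect_matchings H \<noteq> {}"
  using assms
proof (induction "card H" arbitrary: H rule: less_induct)
  case less
  show ?case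
  proof (cases "H = {}")
    case True
    then have "{} \<in> perfect_matchings H" by (simp add: perfect_matchings_def partition_on_def)
    then show ?thesis by blast
  next
    case False
    then obtain x where x: "x \<in> H" by blast
    have "H \<noteq> {x}" using less.prems by auto
    then obtain y where y: "y \<in> H" "y \<noteq> x" using x by blast
    let ?H = "H - {x, y}"
    have c: "card ?H = card H - 2" using x y less.prems by (subst card_Diff_subset) auto
    have pos: "card H > 0" using x less.prems card_gt_0_iff by blast
    have "perfect_matchings ?H \<noteq> {}"
      by (rule less.hyps) (use c pos less.prems in auto)
    then obtain M where M: "M \<in> perfect_matchings ?H" by blast
    have "\<Union> (insert {x, y} M) = H"
      using M x y by (auto simp: perfect_matchings_def partition_on_def)
    moreover have "disjoint (insert {x, y} M)"
      using M by (intro disjointI) (auto simp: perfect_matchings_def partition_on_def disjoint_def)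
    ultimately have "insert {x, y} M \<in> perfect_matchings H"
      using M y by (auto simp: perfect_matchings_def partition_on_def)
    then show ?thesis by blast
  qed
qed

lemma vertex_degree_multigraph_of_matching:
  assumes "M \<in> perfect_matchings (half_edges n d)" "v \<in> {1..n}"
  shows "vertex_degree (multigraph_of_matching n M) v = d v"
proof -
  let ?H = "half_edges n d"
  have M: "partition_on ?H M" using assms by (simp add: perfect_matchings_def partition_on_def)
  have finM: "finite M" using finite_elements[OF finite_half_edges M] .
  have fine: "finite e" if "e \<in> M" for e
    using that partition_onD1[OF M] finite_half_edges[of n d] by (metis Sup_upper finite_subset)
  have cnt: "count (image_mset fst (mset_set e)) v = card {h \<in> e. fst h = v}" if "e \<in> M" for e
    using fine[OF that] by (simp add: count_image_mset vimage_def Int_def conj_commute)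
  have "vertex_degree (multigraph_of_matching n M) v
      = (\<Sum>e\<in>M. count (image_mset fst (mset_set e)) v)"
    by (simp add: vertex_degree_def multigraph_of_matching_def sum_unfold_sum_mset
        image_mset.compositionality o_def)
  also have "\<dots> = (\<Sum>e\<in>M. card {h \<in> e. fst h = v})"
    by (rule sum.cong) (use cnt in auto)
  also have "\<dots> = card (\<Union>e\<in>M. {h \<in> e. fst h = v})"
    by (rule card_UN_disjoint[symmetric])
       (use finM fine partition_onD2[OF M] in \<open>auto simp: disjoint_def\<close>)
  also have "(\<Union>e\<in>M. {h \<in> e. fst h = v}) = {v} \<times> {..<d v}"
  proof -
    have "(\<Union>e\<in>M. {h \<in> e. fst h = v}) = {h \<in> \<Union>M. fst h = v}" by blast
    also have "\<dots> = {h \<in> ?H. fst h = v}" using partition_onD1[OF M] by simp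
    finally show ?thesis using assms(2) by (auto simp: half_edges_def)
  qed
  finally show ?thesis by (simp add: card_cartesian_product)
qed

lemma max_degree_multigraph_of_matching:
  assumes "M \<in> perfect_matchings (half_edges n d)"
  shows "max_degree (multigraph_of_matching n M) = Max (d ` {1..n})"
proof -
  have "verts (multigraph_of_matching n M) = {1..n}"
    by (simp add: multigraph_of_matching_def)
  then show ?thesis
    unfolding max_degree_def
    using vertex_degree_multigraph_of_matching[OF assms] by (metis (no_types, lifting) image_cong)
qed

end

theory Submission
  imports Defs "HOL-Real_Asymp.Real_Asymp"
begin

text \<open>Given the degrees, a component is explored by revealing the partner of one active half-edge after
  another.  The component of \<open>v\<close> is the smallest vertex set \<open>W\<close> containing \<open>v\<close> whose half-edges are closed under
  the matching, so that the exploration becomes an induction on the set of unpaired half-edges in which one only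
  counts matchings.

  A discovered vertex \<open>w\<close> is chosen with probability proportional to its degree \<open>d w\<close> and changes the number of
  active half-edges by \<open>d w - 2\<close>, on average by \<open>\<nu> - 1\<close>.  Hence starting at \<open>v\<close> one expects \<open>d v / (1 - \<nu>)\<close>
  vertices.  Put \<open>a = n powr (1 / (\<gamma> - 1))\<close>, which is the order of the maximum degree and is \<open>o(\<surd>n)\<close>.  Call a vertex
  big if its degree exceeds \<open>1 / \<theta>\<close> with \<open>1 / \<theta>\<close> slightly below \<open>a\<close>.  As long as no big vertex is met,
  \<open>exp (\<theta> * (active + \<kappa> * discovered))\<close> with \<open>\<kappa> < 1 - \<nu>\<close> is a supermartingale, so that the probability of
  exceeding \<open>(d v + \<epsilon> a) / \<kappa>\<close> vertices is \<open>o(1 / n)\<close>, and a union bound over \<open>v\<close> applies.  There are so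
  few big vertices that with high probability no two of them share a component: the number of active half-edges is
  itself a supermartingale, which bounds the probability of hitting a second one.  For the lower bound one starts at a
  vertex of maximum degree and uses \<open>exp (- \<theta> * (active + \<kappa> * discovered))\<close> with \<open>\<kappa> > 1 - \<nu>\<close> and
  \<open>\<theta>\<close> tending to 0 slowly.  The drifts of both supermartingales are controlled by Chebyshev's inequality, and
  conditioning on an even sum costs only a constant factor.\<close>

section \<open>Counting perfect matchings\<close>

lemma perfect_matchings_D:
  assumes "M \<in> perfect_matchings H"
  shows "\<Union>M = H" "e \<in> M \<Longrightarrow> card e = 2" "e \<in> M \<Longrightarrow> f \<in> M \<Longrightarrow> e \<noteq> f \<Longrightarrow> e \<inter> f = {}"
  using assms by (auto simp: perfect_matchings_def partition_on_def disjoint_def)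

lemma perfect_matchings_insert:
  assumes "x \<in> H" "y \<in> H" "x \<noteq> y" "M \<in> perfect_matchings (H - {x, y})"
  shows "insert {x, y} M \<in> perfect_matchings H" "{x, y} \<notin> M"
proof -
  note D = perfect_matchings_D[OF assms(4)]
  show "{x, y} \<notin> M" using D(1) by blast
  have "\<Union> (insert {x, y} M) = H" using D(1) assms by auto
  moreover have "disjoint (insert {x, y} M)"
    using assms(4) D(1) by (intro disjointI) (auto simp: perfect_matchings_def partition_on_def disjoint_def)
  ultimately show "insert {x, y} M \<in> perfect_matchings H"
    using assms by (auto simp: perfect_matchings_def partition_on_def)
qed

lemma perfect_matchings_remove:
  assumes "M \<in> perfect_matchings H" "{x, y} \<in> M"
  shows "M - {{x, y}} \<in> perfect_matchings (H - {x, y})"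
proof -
  note D = perfect_matchings_D[OF assms(1)]
  have "\<Union> (M - {{x, y}}) = H - {x, y}"
  proof -
    have "e \<inter> {x, y} = {}" if "e \<in> M - {{x, y}}" for e
      using D(3)[of e "{x, y}"] that assms(2) by blast
    then have "\<Union> (M - {{x, y}}) \<inter> {x, y} = {}" by blast
    moreover have "\<Union> (M - {{x, y}}) \<union> {x, y} = H"
      using D(1) assms(2) by blast
    ultimately show ?thesis by blast
  qed
  moreover have "disjoint (M - {{x, y}})" "{} \<notin> M" "\<forall>e\<in>M. card e = 2"
    using assms(1) by (auto simp: perfect_matchings_def partition_on_def disjoint_def)
  ultimately show ?thesis by (auto simp: perfect_matchings_def partition_on_def)
qed

lemma perfect_matchings_partner:
  assumes "M \<in> perfect_matchings H" "x \<in> H"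
  obtains y where "y \<in> H" "y \<noteq> x" "{x, y} \<in> M"
proof -
  note D = perfect_matchings_D[OF assms(1)]
  obtain e where e: "e \<in> M" "x \<in> e" using D(1) assms(2) by blast
  then obtain u v where "e = {u, v}" "u \<noteq> v" using D(2) by (metis card_2_iff)
  moreover have "u \<in> H" "v \<in> H" using e calculation D(1) by auto
  ultimately show thesis using that[of u] that[of v] e by (auto simp: insert_commute)
qed

text \<open>Splits by the partner y of x: adding or removing the edge {x, y} is a bijection between
  the matchings of H that contain it and those of \<open>H - {x, y}\<close>. This is the counting
  form of revealing one edge.\<close>

lemma card_perfect_matchings_filter:
  assumes "finite H" "x \<in> H"
  shows "card {M \<in> perfect_matchings H. P M} =
    (\<Sum>y\<in>H - {x}. card {M \<in> perfect_matchings (H - {x, y}). P (insert {x, y} M)})"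
proof -
  let ?S = "\<lambda>y. {M \<in> perfect_matchings (H - {x, y}). P (insert {x, y} M)}"
  have eq: "{M \<in> perfect_matchings H. P M} = (\<Union>y\<in>H - {x}. insert {x, y} ` ?S y)"
  proof (intro equalityI subsetI)
    fix M assume M: "M \<in> {M \<in> perfect_matchings H. P M}"
    then obtain y where y: "y \<in> H" "y \<noteq> x" "{x, y} \<in> M"
      using perfect_matchings_partner assms(2) by (metis (no_types, lifting) mem_Collect_eq)
    then have "M = insert {x, y} (M - {{x, y}})" by blast
    moreover have "M - {{x, y}} \<in> perfect_matchings (H - {x, y})"
      using M y(3) by (simp add: perfect_matchings_remove)
    moreover have "P (insert {x, y} (M - {{x, y}}))"
      using M calculation(1) by simp
    ultimately have "M \<in> insert {x, y} ` ?S y" by (intro image_eqI[of _ _ "M - {{x, y}}"]) simp_all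
    then show "M \<in> (\<Union>y\<in>H - {x}. insert {x, y} ` ?S y)" using y by (intro UN_I[of y]) simp_all
  next
    fix M assume "M \<in> (\<Union>y\<in>H - {x}. insert {x, y} ` ?S y)"
    then obtain y M' where "y \<in> H" "y \<noteq> x" "M' \<in> ?S y" "M = insert {x, y} M'" by auto
    then show "M \<in> {M \<in> perfect_matchings H. P M}"
      using perfect_matchings_insert(1)[of x H y M'] assms(2) by simp
  qed
  have fin: "finite (?S y)" for y
    using finite_perfect_matchings[of "H - {x, y}"] assms(1) by simp
  have "card {M \<in> perfect_matchings H. P M} = (\<Sum>y\<in>H - {x}. card (insert {x, y} ` ?S y))"
    unfolding eq
  proof (rule card_UN_disjoint)
    show "\<forall>y\<in>H - {x}. \<forall>z\<in>H - {x}. y \<noteq> z \<longrightarrow> insert {x, y} ` ?S y \<inter> insert {x, z} ` ?S z = {}"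
    proof (intro ballI impI)
      fix y z assume yz: "y \<in> H - {x}" "z \<in> H - {x}" "y \<noteq> z"
      have False if "M \<in> insert {x, y} ` ?S y" "M \<in> insert {x, z} ` ?S z" for M
      proof -
        have M: "M \<in> perfect_matchings H"
          using that(1) perfect_matchings_insert(1)[of x H y] yz assms by auto
        have "{x, y} \<in> M" using that(1) by (elim imageE) simp
        moreover have "{x, z} \<in> M" using that(2) by (elim imageE) simp
        moreover have "{x, y} \<noteq> {x, z}" using yz by (auto simp: doubleton_eq_iff)
        ultimately have "{x, y} \<inter> {x, z} = {}" by (rule perfect_matchings_D(3)[OF M])
        then show False by simp
      qed
      then show "insert {x, y} ` ?S y \<inter> insert {x, z} ` ?S z = {}" by (intro equals0I) (elim IntE)
    qed
  next
    show "finite (H - {x})" using assms(1) by simp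
    show "\<forall>y\<in>H - {x}. finite (insert {x, y} ` ?S y)" by (intro ballI finite_imageI fin)
  qed
  also have "\<dots> = (\<Sum>y\<in>H - {x}. card (?S y))"
  proof (rule sum.cong)
    fix y assume y: "y \<in> H - {x}"
    have "inj_on (insert {x, y}) (?S y)"
    proof (rule inj_onI)
      fix M N assume "M \<in> ?S y" "N \<in> ?S y" and eq: "insert {x, y} M = insert {x, y} N"
      then have "{x, y} \<notin> M" "{x, y} \<notin> N"
        using perfect_matchings_insert(2)[of x H y] y assms by auto
      then show "M = N" using eq by (simp add: insert_ident)
    qed
    then show "card (insert {x, y} ` ?S y) = card (?S y)" by (rule card_image)
  qed simp
  finally show ?thesis .
qed

text \<open>The double factorial (h - 1)!! for even h, and 0 for odd h. The recursion counts the
  possible partners of a fixed point.\<close>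

fun matching_number :: "nat \<Rightarrow> nat" where
  "matching_number 0 = 1"
| "matching_number (Suc 0) = 0"
| "matching_number (Suc (Suc n)) = Suc n * matching_number n"

lemma card_perfect_matchings:
  assumes "finite H"
  shows "card (perfect_matchings H) = matching_number (card H)"
  using assms
proof (induction "card H" arbitrary: H rule: less_induct)
  case less
  show ?case
  proof (cases "H = {}")
    case True
    have "perfect_matchings H = {{}}"
      using True by (auto simp: perfect_matchings_def partition_on_def)
    then show ?thesis using True by simp
  next
    case False
    then obtain x where x: "x \<in> H" by blast
    have c: "card (H - {x, y}) = card H - 2" if "y \<in> H - {x}" for y
      using that x less.prems by (subst card_Diff_subset) auto
    have pos: "card H > 0" using x less.prems by (auto simp: card_gt_0_iff)
    have "card (perfect_matchings H)
        = (\<Sum>y\<in>H - {x}. card (perfect_matchings (H - {x, y})))"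
      using card_perfect_matchings_filter[OF less.prems x, of "\<lambda>_. True"] by simp
    also have "\<dots> = (\<Sum>y\<in>H - {x}. matching_number (card H - 2))"
    proof (rule sum.cong)
      fix y assume y: "y \<in> H - {x}"
      show "card (perfect_matchings (H - {x, y})) = matching_number (card H - 2)"
        using less.hyps[of "H - {x, y}"] c[OF y] pos less.prems by simp
    qed simp
    also have "\<dots> = (card H - 1) * matching_number (card H - 2)"
      using x less.prems by simp
    also have "\<dots> = matching_number (card H)"
      using pos by (cases "card H" rule: matching_number.cases) auto
    finally show ?thesis .
  qed
qed

lemma matching_number_rec: "h > 0 \<Longrightarrow> matching_number h = (h - 1) * matching_number (h - 2)"
  by (cases h rule: matching_number.cases) auto

text \<open>The partner of x is uniform among the other \<open>card H - 1\<close> points. As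
  \<open>c y\<close> bounds the conditional probability of P given the partner y, the hypothesis on
  the sum says that q is at least an average; for a potential this is the supermartingale
  inequality.\<close>

lemma card_perfect_matchings_le_average:
  fixes c :: "'a \<Rightarrow> real" and q :: real
  assumes "finite H" "x \<in> H"
    and "\<And>y. y \<in> H - {x} \<Longrightarrow>
      card {M \<in> perfect_matchings (H - {x, y}). P (insert {x, y} M)} \<le> c y * matching_number (card H - 2)"
    and "(\<Sum>y\<in>H - {x}. c y) \<le> q * (real (card H) - 1)"
  shows "card {M \<in> perfect_matchings H. P M} \<le> q * matching_number (card H)"
proof -
  have pos: "card H > 0" using assms by (auto simp: card_gt_0_iff)
  have "real (card {M \<in> perfect_matchings H. P M})
      \<le> (\<Sum>y\<in>H - {x}. c y * matching_number (card H - 2))"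
    unfolding card_perfect_matchings_filter[OF assms(1,2)] of_nat_sum
    by (rule sum_mono) (use assms(3) in auto)
  also have "\<dots> = (\<Sum>y\<in>H - {x}. c y) * matching_number (card H - 2)"
    by (simp add: sum_distrib_right)
  also have "\<dots> \<le> q * (real (card H) - 1) * matching_number (card H - 2)"
    by (rule mult_right_mono) (use assms in auto)
  also have "\<dots> = q * matching_number (card H)"
    using pos by (simp add: matching_number_rec[OF pos] of_nat_diff)
  finally show ?thesis .
qed

section \<open>Exploring a component\<close>

definition stubs :: "(nat \<Rightarrow> nat) \<Rightarrow> nat set \<Rightarrow> (nat \<times> nat) set" where
  "stubs d W = (SIGMA w:W. {..<d w})"

definition closed_under :: "'a set set \<Rightarrow> 'a set \<Rightarrow> bool" where
  "closed_under M Z \<longleftrightarrow> (\<forall>e\<in>M. e \<subseteq> Z \<or> e \<inter> Z = {})"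

lemma finite_stubs [simp]: "finite W \<Longrightarrow> finite (stubs d W)"
  by (simp add: stubs_def)

lemma stubs_empty [simp]: "stubs d {} = {}"
  by (simp add: stubs_def)

lemma stubs_insert: "stubs d (insert w W) = stubs d {w} \<union> stubs d W"
  by (auto simp: stubs_def)

lemma stubs_mono: "V \<subseteq> W \<Longrightarrow> stubs d V \<subseteq> stubs d W"
  by (auto simp: stubs_def)

lemma card_stubs: "finite W \<Longrightarrow> card (stubs d W) = (\<Sum>w\<in>W. d w)"
  by (simp add: stubs_def)

lemma mem_stubs: "h \<in> stubs d W \<longleftrightarrow> fst h \<in> W \<and> snd h < d (fst h)"
  by (cases h) (auto simp: stubs_def)

text \<open>A uniform half-edge yields a vertex biased by its degree; hence the weights
  \<open>d w\<close> in all drift sums below.\<close>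

lemma sum_stubs:
  fixes g :: "nat \<Rightarrow> real"
  assumes "finite W"
  shows "(\<Sum>y\<in>stubs d W. g (fst y)) = (\<Sum>w\<in>W. d w * g w)"
proof -
  have "(\<Sum>y\<in>stubs d W. g (fst y)) = (\<Sum>(w, i)\<in>(SIGMA w:W. {..<d w}). g w)"
    unfolding stubs_def by (rule sum.cong) auto
  also have "\<dots> = (\<Sum>w\<in>W. \<Sum>i<d w. g w)"
    by (rule sum.Sigma[symmetric]) (use assms in auto)
  finally show ?thesis by simp
qed

text \<open>The active half-edges after an active \<open>x\<close> has been paired with a half-edge \<open>y\<close> of an undiscovered
  vertex.\<close>

definition explore :: "(nat \<Rightarrow> nat) \<Rightarrow> (nat \<times> nat) set \<Rightarrow> nat \<times> nat \<Rightarrow> nat \<times> nat \<Rightarrow> (nat \<times> nat) set" where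
  "explore d A x y = A - {x} \<union> (stubs d {fst y} - {y})"

lemma closed_under_insert_iff:
  assumes "\<Union>M \<inter> {x, y} = {}"
  shows "closed_under (insert {x, y} M) Z \<longleftrightarrow> (x \<in> Z \<longleftrightarrow> y \<in> Z) \<and> closed_under M (Z - {x, y})"
proof -
  have "e \<subseteq> Z - {x, y} \<or> e \<inter> (Z - {x, y}) = {} \<longleftrightarrow> e \<subseteq> Z \<or> e \<inter> Z = {}" if "e \<in> M" for e
  proof -
    have "x \<notin> e" "y \<notin> e" using assms that by auto
    then show ?thesis by auto
  qed
  then show ?thesis by (auto simp: closed_under_def)
qed

text \<open>Ensures that deleting a discovered vertex raises the drift sum by at most \<theta>.
  Terms with k = 0 vanish and those with k \<ge> 2 are nonnegative; for k = 1, exp t \<ge> 1 + t and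
  \<kappa> \<ge> 0 suffice.\<close>

lemma exp_drift_ge:
  fixes \<theta> \<kappa> :: real and k :: nat
  assumes "0 \<le> \<theta>" "0 \<le> \<kappa>"
  shows "- \<theta> \<le> k * (exp (\<theta> * (real k - 2 + \<kappa>)) - 1)"
proof -
  consider "k = 0" | "k = 1" | "k \<ge> 2" by linarith
  then show ?thesis
  proof cases
    case 2
    have "1 + \<theta> * (\<kappa> - 1) \<le> exp (\<theta> * (\<kappa> - 1))" by (rule exp_ge_add_one_self)
    moreover have "- \<theta> \<le> \<theta> * (\<kappa> - 1)" using assms by (simp add: algebra_simps)
    moreover have "k * (exp (\<theta> * (real k - 2 + \<kappa>)) - 1) = exp (\<theta> * (\<kappa> - 1)) - 1" using 2 by simp
    ultimately show ?thesis by linarith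
  next
    case 3
    then have "0 \<le> \<theta> * (real k - 2 + \<kappa>)" using assms by simp
    then have "0 \<le> k * (exp (\<theta> * (real k - 2 + \<kappa>)) - 1)" by simp
    then show ?thesis using assms by linarith
  qed (use assms in simp)
qed

text \<open>A consists of the active half-edges, U of the undiscovered vertices open to the
  exploration, B of the half-edges of forbidden vertices. By disjointness an active half-edge finds
  its partner in exactly one of the three parts of the unpaired half-edges.\<close>

locale exploration =
  fixes d :: "nat \<Rightarrow> nat" and A B :: "(nat \<times> nat) set" and U :: "nat set"
  assumes finite_A: "finite A" and finite_B: "finite B" and finite_U: "finite U"
    and disjoint_AU: "A \<inter> stubs d U = {}" and disjoint_AB: "A \<inter> B = {}"
    and disjoint_UB: "stubs d U \<inter> B = {}"
begin

abbreviation "pool \<equiv> A \<union> stubs d U \<union> B"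

lemma finite_pool: "finite pool"
  using finite_A finite_B finite_U by simp

lemma sum_pool_remove:
  fixes c :: "nat \<times> nat \<Rightarrow> real"
  assumes "x \<in> A"
  shows "(\<Sum>y\<in>pool - {x}. c y) = (\<Sum>y\<in>A - {x}. c y) + (\<Sum>y\<in>stubs d U. c y) + (\<Sum>y\<in>B. c y)"
proof -
  have "pool - {x} = (A - {x} \<union> stubs d U) \<union> B"
    using assms disjoint_AU disjoint_AB disjoint_UB by blast
  also have "(\<Sum>y\<in>\<dots>. c y) = (\<Sum>y\<in>A - {x} \<union> stubs d U. c y) + (\<Sum>y\<in>B. c y)"
    using finite_A finite_B finite_U disjoint_AB disjoint_UB by (intro sum.union_disjoint) auto
  also have "(\<Sum>y\<in>A - {x} \<union> stubs d U. c y) = (\<Sum>y\<in>A - {x}. c y) + (\<Sum>y\<in>stubs d U. c y)"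
    using finite_A finite_U disjoint_AU by (intro sum.union_disjoint) auto
  finally show ?thesis .
qed

lemma card_pool_remove:
  assumes "x \<in> A"
  shows "real (card pool) - 1 = real (card (A - {x})) + (\<Sum>w\<in>U. real (d w)) + real (card B)"
proof -
  have "real (card pool) - 1 = real (card (pool - {x}))"
    using assms finite_pool card_gt_0_iff[of pool] by (subst card_Diff_singleton) auto
  also have "\<dots> = real (card (A - {x})) + real (card (stubs d U)) + real (card B)"
    using sum_pool_remove[OF assms, of "\<lambda>_. 1"] by simp
  finally show ?thesis using finite_U by (simp add: card_stubs)
qed

lemma active_step:
  assumes "x \<in> A" "y \<in> A"
  shows "exploration d (A - {x, y}) B U" "A - {x, y} \<union> stubs d U \<union> B = pool - {x, y}"
proof -
  show "exploration d (A - {x, y}) B U"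
    using finite_A finite_B finite_U disjoint_AU disjoint_AB disjoint_UB by unfold_locales auto
  show "A - {x, y} \<union> stubs d U \<union> B = pool - {x, y}"
    using assms disjoint_AU disjoint_AB by blast
qed

text \<open>Pairing two active half-edges discovers no vertex: both ends belong to the set whatever
  W is, so W stays the same.\<close>

lemma active_step_closed:
  assumes "x \<in> A" "y \<in> A" "W \<subseteq> U" "\<Union>M = pool - {x, y}"
  shows "closed_under (insert {x, y} M) (A \<union> stubs d W) \<longleftrightarrow> closed_under M (A - {x, y} \<union> stubs d W)"
proof -
  have "A \<union> stubs d W - {x, y} = A - {x, y} \<union> stubs d W"
    using assms disjoint_AU stubs_mono[of W U d] by blast
  then show ?thesis using assms by (subst closed_under_insert_iff) auto
qed

lemma vertex_step:
  assumes "x \<in> A" "y \<in> stubs d U"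
  shows "exploration d (explore d A x y) B (U - {fst y})"
    and "explore d A x y \<union> stubs d (U - {fst y}) \<union> B = pool - {x, y}"
    and "real (card (explore d A x y)) = real (card A) + real (d (fst y)) - 2"
proof -
  let ?w = "fst y"
  have w: "?w \<in> U" "y \<in> stubs d {?w}" using assms(2) by (auto simp: mem_stubs)
  have split: "stubs d U = stubs d {?w} \<union> stubs d (U - {?w})"
    using w(1) stubs_insert[of d ?w "U - {?w}"] by (simp add: insert_absorb)
  have disj: "stubs d {?w} \<inter> stubs d (U - {?w}) = {}" by (auto simp: mem_stubs)
  have xy: "x \<noteq> y" "x \<notin> stubs d U" "y \<notin> A" "y \<notin> B" "x \<notin> B"
    using assms disjoint_AU disjoint_AB disjoint_UB by auto
  show "exploration d (explore d A x y) B (U - {?w})"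
  proof
    show "explore d A x y \<inter> stubs d (U - {?w}) = {}"
      using disjoint_AU disj unfolding explore_def split by blast
    show "explore d A x y \<inter> B = {}"
      using disjoint_AB disjoint_UB unfolding explore_def split by blast
    show "stubs d (U - {?w}) \<inter> B = {}" using disjoint_UB unfolding split by blast
  qed (use finite_A finite_B finite_U in \<open>auto simp: explore_def\<close>)
  show "explore d A x y \<union> stubs d (U - {?w}) \<union> B = pool - {x, y}"
    using xy disj w(2) unfolding explore_def split by blast
  have "card (explore d A x y) = card (A - {x}) + card (stubs d {?w} - {y})"
    unfolding explore_def
    using finite_A disjoint_AU split by (intro card_Un_disjoint) auto
  moreover have "card (stubs d {?w} - {y}) = d ?w - 1"
    using w(2) by (simp add: card_Diff_singleton card_stubs)
  moreover have "card A > 0" using assms(1) finite_A by (auto simp: card_gt_0_iff)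
  moreover have "d ?w > 0" using w(2) by (auto simp: mem_stubs)
  ultimately show "real (card (explore d A x y)) = real (card A) + real (d ?w) - 2"
    using assms(1) finite_A by (simp add: of_nat_diff)
qed

text \<open>As x lies in \<open>A \<union> stubs d W\<close> for every W, closure forces the vertex
  of its partner into W. Once that vertex is moved from W to the active side, the condition has its
  old form, which makes the induction on unpaired half-edges possible.\<close>

lemma vertex_step_closed:
  assumes "x \<in> A" "y \<in> stubs d U" "W \<subseteq> U" "\<Union>M = pool - {x, y}"
  shows "closed_under (insert {x, y} M) (A \<union> stubs d W) \<longleftrightarrow>
    fst y \<in> W \<and> closed_under M (explore d A x y \<union> stubs d (W - {fst y}))"
proof -
  let ?w = "fst y"
  have y: "snd y < d ?w" "y \<notin> A" using assms(2) disjoint_AU by (auto simp: mem_stubs)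
  have "A \<union> stubs d W - {x, y} = explore d A x y \<union> stubs d (W - {?w})" if "?w \<in> W"
  proof -
    have split: "stubs d W = stubs d {?w} \<union> stubs d (W - {?w})"
      using that stubs_insert[of d ?w "W - {?w}"] by (simp add: insert_absorb)
    have "y \<notin> stubs d (W - {?w})" by (simp add: mem_stubs)
    moreover have "x \<notin> stubs d W" using assms(1,3) disjoint_AU stubs_mono[of W U d] by blast
    ultimately show ?thesis using y(2) unfolding explore_def split by blast
  qed
  moreover have "y \<in> A \<union> stubs d W \<longleftrightarrow> ?w \<in> W" using y by (simp add: mem_stubs)
  ultimately show ?thesis using assms by (subst closed_under_insert_iff) auto
qed

lemma sum_U_remove:
  fixes g :: "nat \<Rightarrow> real"
  assumes "w \<in> U"
  shows "(\<Sum>v\<in>U - {w}. g v) = (\<Sum>v\<in>U. g v) - g w"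
  using assms finite_U by (simp add: sum_diff1)

end

text \<open>With \<open>hit\<close>, the event includes explorations that run into \<open>B\<close>; this costs the term \<open>\<beta> * card A\<close>.
  The summands \<open>m * \<theta>\<close> and \<open>m\<close> in the hypotheses absorb the removal of up to \<open>m\<close> discovered vertices of
  degree 1, the only ones with a negative contribution, from the sums over \<open>U\<close>.\<close>

lemma card_long_exploration_le:
  fixes \<theta> \<kappa> \<beta> :: real and m :: nat
  assumes "exploration d A B U" "0 \<le> \<theta>" "0 \<le> \<kappa>" "\<kappa> \<le> 1" "0 \<le> \<beta>"
    and "(\<Sum>w\<in>U. d w * (exp (\<theta> * (real (d w) - 2 + \<kappa>)) - 1)) + m * \<theta> \<le> 0"
    and "(if hit then card B else 0) + \<beta> * ((\<Sum>w\<in>U. d w * (real (d w) - 2)) + m) \<le> 0"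
  shows "card {M \<in> perfect_matchings (A \<union> stubs d U \<union> B).
      (hit \<or> (\<exists>W\<subseteq>U. closed_under M (A \<union> stubs d W))) \<and>
      (\<forall>W\<subseteq>U. closed_under M (A \<union> stubs d W) \<longrightarrow> m \<le> card W)}
    \<le> (exp (\<theta> * (card A - \<kappa> * m)) + \<beta> * card A) * matching_number (card (A \<union> stubs d U \<union> B))"
  using assms(1,6,7)
proof (induction "card (A \<union> stubs d U \<union> B)" arbitrary: A U m rule: less_induct)
  case less
  interpret exploration d A B U by fact
  \<comment> \<open>Here m counts the vertices still to be discovered. After a run into B no W
    completes A to a closed set; the second conjunct then holds vacuously, and \<open>hit\<close>
    decides whether the event counts.\<close>
  define Ev where "Ev A U m M \<longleftrightarrow> (hit \<or> (\<exists>W\<subseteq>U. closed_under M (A \<union> stubs d W))) \<and>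
      (\<forall>W\<subseteq>U. closed_under M (A \<union> stubs d W) \<longrightarrow> m \<le> card W)" for A U m M
  \<comment> \<open>Discovered vertices enter through the decrease of m, which explains the sign of
    \<kappa> * m; the summand with \<beta> pays for running into B.\<close>
  define b where "b A m = exp (\<theta> * (real (card A) - \<kappa> * real m)) + \<beta> * real (card A)" for A :: "(nat \<times> nat) set" and m
  have fin: "finite {M \<in> perfect_matchings X. P M}" if "finite X" for P and X :: "(nat \<times> nat) set"
    using finite_perfect_matchings[OF that] by simp
  have all: "card {M \<in> perfect_matchings X. P M} \<le> matching_number (card X)"
    if "finite X" for P and X :: "(nat \<times> nat) set"
    unfolding card_perfect_matchings[OF that, symmetric]
    by (rule card_mono) (auto simp: finite_perfect_matchings[OF that])
  have IH: "card {M \<in> perfect_matchings (pool - {x, y}). Ev A' U' m' M}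
      \<le> b A' m' * matching_number (card pool - 2)"
    if "x \<in> A" "y \<in> pool - {x}" "exploration d A' B U'" "A' \<union> stubs d U' \<union> B = pool - {x, y}"
      "(\<Sum>w\<in>U'. d w * (exp (\<theta> * (real (d w) - 2 + \<kappa>)) - 1)) + m' * \<theta> \<le> 0"
      "(if hit then card B else 0) + \<beta> * ((\<Sum>w\<in>U'. d w * (real (d w) - 2)) + m') \<le> 0"
    for x y A' U' m'
  proof -
    have c: "card (pool - {x, y}) = card pool - 2" using that(1,2) finite_pool by (subst card_Diff_subset) auto
    have "card pool > 0" using that(1) finite_pool by (auto simp: card_gt_0_iff)
    then have "card (A' \<union> stubs d U' \<union> B) < card pool" unfolding that(4) c by simp
    from less.hyps[OF this that(3,5,6)] show ?thesis
      unfolding that(4) c Ev_def b_def .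
  qed
  consider "m = 0" | "m > 0" "A = {}" | x where "m > 0" "x \<in> A" by blast
  then have "card {M \<in> perfect_matchings pool. Ev A U m M} \<le> b A m * matching_number (card pool)"
  proof cases
    case 1
    have "1 \<le> b A m" using 1 assms(2,5) by (simp add: b_def add_increasing2)
    then have "1 * real (matching_number (card pool)) \<le> b A m * matching_number (card pool)"
      by (rule mult_right_mono) simp
    then show ?thesis using all[OF finite_pool, of "Ev A U m"] by linarith
  next
    case 2
    \<comment> \<open>With no active half-edge the empty W is closed, and it has fewer than m
      elements.\<close>
    have "\<not> Ev A U m M" for M
      using 2 unfolding Ev_def by (auto simp: closed_under_def intro!: exI[of _ "{}"])
    then show ?thesis using 2 by (simp add: b_def)
  next
    case 3
    define E where "E = exp (\<theta> * (real (card A) - \<kappa> * real m))"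
    \<comment> \<open>Bounds for the event given the partner y. For y in A the potential does not
      increase. For y in B the term \<open>b A m\<close> is kept beside the cost of a hit, so that
      \<open>b A m\<close> can be split off for every partner.\<close>
    define c where "c y = (if y \<in> A then b A m else if y \<in> stubs d U then
       E * exp (\<theta> * (real (d (fst y)) - 2 + \<kappa>)) + \<beta> * (real (card A) + real (d (fst y)) - 2)
       else b A m + (if hit then 1 else 0))" for y
    have E: "E > 0" "b A m = E + \<beta> * card A" by (simp_all add: E_def b_def)
    have b0: "0 \<le> b A m" using assms(5) by (simp add: b_def)
    show ?thesis
    proof (rule card_perfect_matchings_le_average[OF finite_pool, of x _ c])
      show "x \<in> pool" using 3 by simp
    next
      fix y assume y: "y \<in> pool - {x}"
      have union: "\<Union>M = pool - {x, y}" if "M \<in> perfect_matchings (pool - {x, y})" for M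
        using perfect_matchings_D(1)[OF that] .
      have finp: "finite (pool - {x, y})" using finite_pool by simp
      consider "y \<in> A" | "y \<in> stubs d U" "y \<notin> A" | "y \<in> B" "y \<notin> stubs d U" "y \<notin> A" using y by blast
      then show "card {M \<in> perfect_matchings (pool - {x, y}). Ev A U m (insert {x, y} M)}
          \<le> c y * matching_number (card pool - 2)"
      proof cases
        assume yA: "y \<in> A"
        have "Ev A U m (insert {x, y} M) \<longleftrightarrow> Ev (A - {x, y}) U m M"
          if "M \<in> perfect_matchings (pool - {x, y})" for M
          unfolding Ev_def using active_step_closed[OF 3(2) yA _ union[OF that]]
          by (metis (no_types, lifting))
        then have "{M \<in> perfect_matchings (pool - {x, y}). Ev A U m (insert {x, y} M)}
            = {M \<in> perfect_matchings (pool - {x, y}). Ev (A - {x, y}) U m M}" by blast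
        then have "real (card {M \<in> perfect_matchings (pool - {x, y}). Ev A U m (insert {x, y} M)})
            \<le> b (A - {x, y}) m * matching_number (card pool - 2)"
          using IH[OF 3(2) y active_step(1,2)[OF 3(2) yA] less.prems(2,3)] by simp
        also have "\<dots> \<le> b A m * matching_number (card pool - 2)"
        proof (rule mult_right_mono)
          have "card (A - {x, y}) \<le> card A" using finite_A by (intro card_mono) auto
          then show "b (A - {x, y}) m \<le> b A m"
            unfolding b_def using assms(2,5) by (intro add_mono mult_left_mono) (auto intro!: mult_left_mono)
        qed simp
        finally show ?thesis using yA by (simp add: c_def)
      next
        assume yU: "y \<in> stubs d U" and yA: "y \<notin> A"
        let ?w = "fst y"
        have w: "?w \<in> U" "d ?w \<ge> 1" using yU by (auto simp: mem_stubs)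
        \<comment> \<open>One direction is enough for an upper bound: inserting the new vertex turns
          a closed W of the remaining problem into one of the present problem and adds at most one
          to its size. Thus m drops by one.\<close>
        have imp: "Ev (explore d A x y) (U - {?w}) (m - 1) M"
          if M: "M \<in> perfect_matchings (pool - {x, y})" and ev: "Ev A U m (insert {x, y} M)" for M
          unfolding Ev_def
        proof (intro conjI allI impI)
          note cl = vertex_step_closed[OF 3(2) yU _ union[OF M]]
          show "hit \<or> (\<exists>W\<subseteq>U - {?w}. closed_under M (explore d A x y \<union> stubs d W))"
          proof (cases hit)
            case False
            then obtain W where W: "W \<subseteq> U" "closed_under (insert {x, y} M) (A \<union> stubs d W)"
              using ev by (auto simp: Ev_def)
            then show ?thesis using cl[of W] by (intro disjI2 exI[of _ "W - {?w}"]) auto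
          qed simp
          fix W assume W: "W \<subseteq> U - {?w}" "closed_under M (explore d A x y \<union> stubs d W)"
          have "closed_under (insert {x, y} M) (A \<union> stubs d (insert ?w W))"
            using W w by (subst cl) (auto simp: insert_Diff_if Diff_insert_absorb subset_Diff_insert)
          moreover have "insert ?w W \<subseteq> U" using W w by auto
          ultimately have "m \<le> card (insert ?w W)" using ev by (simp add: Ev_def)
          also have "\<dots> \<le> Suc (card W)" by (rule card_insert_le_m1) auto
          finally show "m - 1 \<le> card W" by simp
        qed
        have "(\<Sum>w\<in>U - {?w}. d w * (exp (\<theta> * (real (d w) - 2 + \<kappa>)) - 1)) + (m - 1 :: nat) * \<theta>
            \<le> (\<Sum>w\<in>U. d w * (exp (\<theta> * (real (d w) - 2 + \<kappa>)) - 1)) + m * \<theta>"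
        proof -
          have "- \<theta> \<le> real (d ?w) * (exp (\<theta> * (real (d ?w) - 2 + \<kappa>)) - 1)"
            using assms by (intro exp_drift_ge)
          moreover have "real (m - 1) * \<theta> = real m * \<theta> - \<theta>" using 3 by (simp add: of_nat_diff algebra_simps)
          ultimately show ?thesis unfolding sum_U_remove[OF w(1)] by linarith
        qed
        moreover have "\<beta> * ((\<Sum>w\<in>U - {?w}. d w * (real (d w) - 2)) + (m - 1 :: nat))
            \<le> \<beta> * ((\<Sum>w\<in>U. d w * (real (d w) - 2)) + m)"
        proof (rule mult_left_mono[OF _ assms(5)])
          \<comment> \<open>This is d (d - 2) \<ge> -1: deleting the vertex raises the linear drift
            by at most 1, which the decrease of m compensates.\<close>
          have "0 \<le> (real (d ?w) - 1)\<^sup>2" by simp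
          then show "(\<Sum>w\<in>U - {?w}. d w * (real (d w) - 2)) + (m - 1 :: nat)
              \<le> (\<Sum>w\<in>U. d w * (real (d w) - 2)) + m"
            unfolding sum_U_remove[OF w(1)] using 3
            by (simp add: of_nat_diff power2_eq_square algebra_simps)
        qed
        ultimately have "card {M \<in> perfect_matchings (pool - {x, y}). Ev (explore d A x y) (U - {?w}) (m - 1) M}
            \<le> b (explore d A x y) (m - 1) * matching_number (card pool - 2)"
          using less.prems(2,3)
          by (intro IH[OF 3(2) y vertex_step(1,2)[OF 3(2) yU]]) linarith+
        moreover have "card {M \<in> perfect_matchings (pool - {x, y}). Ev A U m (insert {x, y} M)}
            \<le> card {M \<in> perfect_matchings (pool - {x, y}). Ev (explore d A x y) (U - {?w}) (m - 1) M}"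
          using imp by (intro card_mono fin[OF finp]) blast
        moreover have "b (explore d A x y) (m - 1) = c y"
        proof -
          have "exp (\<theta> * (real (card A) + real (d ?w) - 2 - \<kappa> * real (m - 1)))
              = E * exp (\<theta> * (real (d ?w) - 2 + \<kappa>))"
            using 3 by (simp add: E_def of_nat_diff algebra_simps flip: exp_add)
          then show ?thesis using yU yA by (simp add: b_def c_def vertex_step(3)[OF 3(2) yU])
        qed
        ultimately show ?thesis by simp
      next
        assume yB: "y \<in> B" "y \<notin> stubs d U" "y \<notin> A"
        show ?thesis
        proof (cases hit)
          case True
          have "1 \<le> c y" using True yB b0 by (simp add: c_def)
          then have "1 * real (matching_number (card pool - 2)) \<le> c y * matching_number (card pool - 2)"
            by (rule mult_right_mono) simp
          moreover have "card (pool - {x, y}) = card pool - 2"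
            using 3 y finite_pool by (subst card_Diff_subset) auto
          ultimately show ?thesis
            using all[OF finp, of "\<lambda>M. Ev A U m (insert {x, y} M)"] by simp
        next
          case False
          have "\<not> Ev A U m (insert {x, y} M)" for M
          proof
            assume "Ev A U m (insert {x, y} M)"
            then obtain W where W: "W \<subseteq> U" "closed_under (insert {x, y} M) (A \<union> stubs d W)"
              using False by (auto simp: Ev_def)
            then have "{x, y} \<subseteq> A \<union> stubs d W \<or> {x, y} \<inter> (A \<union> stubs d W) = {}"
              unfolding closed_under_def by simp
            then have "y \<in> A \<union> stubs d W" using 3(2) by auto
            moreover have "y \<notin> stubs d W" using yB(2) stubs_mono[OF W(1)] by auto
            ultimately show False using yB(3) by simp
          qed
          then show ?thesis using b0 yB by (simp add: c_def)
        qed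
      qed
    next
      have "(\<Sum>y\<in>pool - {x}. c y) = (\<Sum>y\<in>A - {x}. c y) + (\<Sum>y\<in>stubs d U. c y) + (\<Sum>y\<in>B. c y)"
        by (rule sum_pool_remove[OF 3(2)])
      also have "(\<Sum>y\<in>A - {x}. c y) = card (A - {x}) * b A m" by (simp add: c_def)
      also have "(\<Sum>y\<in>B. c y) = (\<Sum>y\<in>B. b A m + (if hit then 1 else 0))"
        using disjoint_AB disjoint_UB by (intro sum.cong) (auto simp: c_def)
      also have "\<dots> = card B * b A m + (if hit then card B else 0)" by (simp add: algebra_simps)
      also have "(\<Sum>y\<in>stubs d U. c y) = (\<Sum>y\<in>stubs d U. E * exp (\<theta> * (real (d (fst y)) - 2 + \<kappa>))
          + \<beta> * (real (card A) + real (d (fst y)) - 2))"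
        using disjoint_AU by (intro sum.cong) (auto simp: c_def)
      also have "\<dots> = (\<Sum>w\<in>U. d w * (E * exp (\<theta> * (real (d w) - 2 + \<kappa>))
          + \<beta> * (real (card A) + real (d w) - 2)))"
        by (rule sum_stubs[OF finite_U, of "\<lambda>w. E * exp (\<theta> * (real (d w) - 2 + \<kappa>))
          + \<beta> * (real (card A) + real (d w) - 2)"])
      also have "\<dots> = (\<Sum>w\<in>U. d w * b A m + E * (d w * (exp (\<theta> * (real (d w) - 2 + \<kappa>)) - 1))
          + \<beta> * (d w * (real (d w) - 2)))"
        unfolding E(2) by (intro sum.cong refl) (simp add: algebra_simps)
      also have "\<dots> = (\<Sum>w\<in>U. real (d w)) * b A m
          + E * (\<Sum>w\<in>U. d w * (exp (\<theta> * (real (d w) - 2 + \<kappa>)) - 1))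
          + \<beta> * (\<Sum>w\<in>U. d w * (real (d w) - 2))"
        by (simp only: sum.distrib sum_distrib_left sum_distrib_right)
      finally have eq: "(\<Sum>y\<in>pool - {x}. c y) = card (A - {x}) * b A m + ((\<Sum>w\<in>U. real (d w)) * b A m
          + E * (\<Sum>w\<in>U. d w * (exp (\<theta> * (real (d w) - 2 + \<kappa>)) - 1))
          + \<beta> * (\<Sum>w\<in>U. d w * (real (d w) - 2))) + (card B * b A m + (if hit then card B else 0))" .
      \<comment> \<open>Beyond \<open>b A m\<close> per partner there remain the drift of the
        exponential, and the drift of \<beta> * \<open>card A\<close> together with the hits. The
        hypotheses make each nonpositive once their nonnegative slack terms are dropped.\<close>
      have "0 \<le> m * \<theta>" using assms(2) by simp
      then have "E * (\<Sum>w\<in>U. d w * (exp (\<theta> * (real (d w) - 2 + \<kappa>)) - 1)) \<le> 0"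
        using E(1) less.prems(2) by (intro mult_nonneg_nonpos) auto
      moreover have "(if hit then card B else 0) + \<beta> * (\<Sum>w\<in>U. d w * (real (d w) - 2)) \<le> 0"
      proof -
        have "0 \<le> \<beta> * m" using assms(5) by simp
        then show ?thesis using less.prems(3) by (simp only: distrib_left)
      qed
      ultimately have "(\<Sum>y\<in>pool - {x}. c y)
          \<le> card (A - {x}) * b A m + (\<Sum>w\<in>U. real (d w)) * b A m + card B * b A m"
        unfolding eq by linarith
      also have "\<dots> = b A m * (real (card pool) - 1)"
        unfolding card_pool_remove[OF 3(2)] by (simp add: algebra_simps)
      finally show "(\<Sum>y\<in>pool - {x}. c y) \<le> b A m * (real (card pool) - 1)" .
    qed
  qed
  then show ?case unfolding Ev_def b_def .
qed

text \<open>The same potential with the opposite sign.  It is a supermartingale only while there are few active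
  half-edges, because pairing two of them lowers their number by 2.\<close>

lemma card_short_exploration_le:
  fixes \<theta> \<kappa> \<Delta> :: real and m :: nat
  assumes "exploration d A {} U" "0 \<le> \<theta>" "0 \<le> \<kappa>" "0 \<le> \<Delta>" "\<And>w. w \<in> U \<Longrightarrow> real (d w) \<le> \<Delta>"
    and "(card A + m * \<Delta>) * (exp (2 * \<theta>) - 1) + m * \<Delta>
      \<le> (\<Sum>w\<in>U. d w * (1 - exp (- \<theta> * (real (d w) - 2 + \<kappa>))))"
  shows "card {M \<in> perfect_matchings (A \<union> stubs d U \<union> {}).
      \<exists>W\<subseteq>U. card W \<le> m \<and> closed_under M (A \<union> stubs d W)}
    \<le> exp (\<theta> * (\<kappa> * m - card A)) * matching_number (card (A \<union> stubs d U \<union> {}))"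
  using assms(1,5,6)
proof (induction "card (A \<union> stubs d U \<union> {})" arbitrary: A U m rule: less_induct)
  case less
  interpret exploration d A "{}" U by fact
  define Ev where "Ev A U m M \<longleftrightarrow> (\<exists>W\<subseteq>U. card W \<le> m \<and> closed_under M (A \<union> stubs d W))" for A U m M
  define b where "b A m = exp (\<theta> * (\<kappa> * real m - real (card A)))" for A :: "(nat \<times> nat) set" and m
  have fin: "finite {M \<in> perfect_matchings X. P M}" if "finite X" for P and X :: "(nat \<times> nat) set"
    using finite_perfect_matchings[OF that] by simp
  have all: "card {M \<in> perfect_matchings X. P M} \<le> matching_number (card X)"
    if "finite X" for P and X :: "(nat \<times> nat) set"
    unfolding card_perfect_matchings[OF that, symmetric]
    by (rule card_mono) (auto simp: finite_perfect_matchings[OF that])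
  have IH: "card {M \<in> perfect_matchings (pool - {x, y}). Ev A' U' m' M}
      \<le> b A' m' * matching_number (card pool - 2)"
    if "x \<in> A" "y \<in> pool - {x}" "exploration d A' {} U'" "A' \<union> stubs d U' \<union> {} = pool - {x, y}"
      "U' \<subseteq> U" "(card A' + m' * \<Delta>) * (exp (2 * \<theta>) - 1) + m' * \<Delta>
      \<le> (\<Sum>w\<in>U'. d w * (1 - exp (- \<theta> * (real (d w) - 2 + \<kappa>))))"
    for x y A' U' m'
  proof -
    have c: "card (pool - {x, y}) = card pool - 2" using that(1,2) finite_pool by (subst card_Diff_subset) auto
    have "card pool > 0" using that(1) finite_pool by (auto simp: card_gt_0_iff)
    then have "card (A' \<union> stubs d U' \<union> {}) < card pool" unfolding that(4) c by simp
    from less.hyps[OF this that(3) less.prems(2) that(6)] that(5) show ?thesis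
      unfolding that(4) c Ev_def b_def by auto
  qed
  have "card {M \<in> perfect_matchings pool. Ev A U m M} \<le> b A m * matching_number (card pool)"
  proof (cases "A = {}")
    case True
    have "1 \<le> b A m" using True assms(2,3) by (simp add: b_def)
    then have "1 * real (matching_number (card pool)) \<le> b A m * matching_number (card pool)"
      by (rule mult_right_mono) simp
    then show ?thesis using all[OF finite_pool, of "Ev A U m"] by linarith
  next
    case False
    then obtain x where x: "x \<in> A" by blast
    \<comment> \<open>Pairing two active half-edges lowers their number by two and multiplies the
      potential by exp (2 * \<theta>). As B is empty, every other partner discovers a
      vertex.\<close>
    define c where "c y = (if y \<in> A then b A m * exp (2 * \<theta>)
       else b A m * exp (- \<theta> * (real (d (fst y)) - 2 + \<kappa>)))" for y
    have b0: "0 \<le> b A m" by (simp add: b_def)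
    have e1: "0 \<le> exp (2 * \<theta>) - 1" using assms(2) by simp
    show ?thesis
    proof (rule card_perfect_matchings_le_average[OF finite_pool, of x _ c])
      show "x \<in> pool" using x by simp
    next
      fix y assume y: "y \<in> pool - {x}"
      have union: "\<Union>M = pool - {x, y}" if "M \<in> perfect_matchings (pool - {x, y})" for M
        using perfect_matchings_D(1)[OF that] .
      have finp: "finite (pool - {x, y})" using finite_pool by simp
      show "card {M \<in> perfect_matchings (pool - {x, y}). Ev A U m (insert {x, y} M)}
          \<le> c y * matching_number (card pool - 2)"
      proof (cases "y \<in> A")
        case True
        have "Ev A U m (insert {x, y} M) \<longleftrightarrow> Ev (A - {x, y}) U m M"
          if "M \<in> perfect_matchings (pool - {x, y})" for M
          unfolding Ev_def using active_step_closed[OF x True _ union[OF that]]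
          by (metis (no_types, lifting))
        then have eq: "{M \<in> perfect_matchings (pool - {x, y}). Ev A U m (insert {x, y} M)}
            = {M \<in> perfect_matchings (pool - {x, y}). Ev (A - {x, y}) U m M}" by blast
        have "card (A - {x, y}) = card A - card {x, y}"
          using x y True finite_A by (subst card_Diff_subset) auto
        moreover have "card {x, y} \<le> card A"
          using x True finite_A by (intro card_mono) auto
        ultimately have cA: "real (card (A - {x, y})) = real (card A) - 2"
        proof -
          assume "card (A - {x, y}) = card A - card {x, y}" "card {x, y} \<le> card A"
          moreover have "card {x, y} = 2" using y by auto
          ultimately show ?thesis by (simp add: of_nat_diff)
        qed
        have "(card (A - {x, y}) + m * \<Delta>) * (exp (2 * \<theta>) - 1) \<le> (card A + m * \<Delta>) * (exp (2 * \<theta>) - 1)"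
          unfolding cA by (rule mult_right_mono[OF _ e1]) simp
        then have "card {M \<in> perfect_matchings (pool - {x, y}). Ev (A - {x, y}) U m M}
            \<le> b (A - {x, y}) m * matching_number (card pool - 2)"
          using less.prems(3) by (intro IH[OF x y active_step(1,2)[OF x True]]) auto
        moreover have "b (A - {x, y}) m = c y"
          using True by (simp add: b_def c_def cA algebra_simps flip: exp_add)
        ultimately show ?thesis by (simp only: eq)
      next
        case False
        then have yU: "y \<in> stubs d U" using y by simp
        let ?w = "fst y"
        have w: "?w \<in> U" "d ?w \<ge> 1" using yU by (auto simp: mem_stubs)
        note cl = vertex_step_closed[OF x yU _ union]
        show ?thesis
        proof (cases "m = 0")
          case True
          \<comment> \<open>No discovery is left, yet the partner of x forces its vertex into
            W.\<close>
          have "\<not> Ev A U m (insert {x, y} M)" if M: "M \<in> perfect_matchings (pool - {x, y})" for M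
          proof
            assume "Ev A U m (insert {x, y} M)"
            then obtain W where W: "W \<subseteq> U" "card W = 0" "closed_under (insert {x, y} M) (A \<union> stubs d W)"
              using True by (auto simp: Ev_def)
            then have "W = {}" using finite_subset[OF W(1) finite_U] by simp
            then show False using cl[OF W(1) M] W(3) by simp
          qed
          then have "{M \<in> perfect_matchings (pool - {x, y}). Ev A U m (insert {x, y} M)} = {}" by blast
          moreover have "0 \<le> c y" using b0 by (simp add: c_def)
          ultimately show ?thesis by (simp only: card.empty) simp
        next
          case m: False
          have imp: "Ev (explore d A x y) (U - {?w}) (m - 1) M"
            if M: "M \<in> perfect_matchings (pool - {x, y})" and ev: "Ev A U m (insert {x, y} M)" for M
          proof -
            obtain W where W: "W \<subseteq> U" "card W \<le> m" "closed_under (insert {x, y} M) (A \<union> stubs d W)"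
              using ev by (auto simp: Ev_def)
            then have "?w \<in> W" "closed_under M (explore d A x y \<union> stubs d (W - {?w}))"
              using cl[OF W(1) M] by auto
            moreover have "finite W" using finite_subset[OF W(1) finite_U] .
            ultimately show ?thesis
              unfolding Ev_def using W by (intro exI[of _ "W - {?w}"]) auto
          qed
          \<comment> \<open>The quantity \<open>card A + m * \<Delta>\<close> bounds the active
            half-edges during all remaining discoveries, so it cannot grow. The separate
            \<open>m * \<Delta>\<close> pays for deleting the new vertex, whose drift term is at
            most its degree.\<close>
          have "(card (explore d A x y) + (m - 1 :: nat) * \<Delta>) * (exp (2 * \<theta>) - 1) + (m - 1 :: nat) * \<Delta>
              \<le> (\<Sum>w\<in>U - {?w}. d w * (1 - exp (- \<theta> * (real (d w) - 2 + \<kappa>))))"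
          proof -
            have D: "real (d ?w) \<le> \<Delta>" using less.prems(2) w by simp
            have m1: "real (m - 1) = real m - 1" using m by (simp add: of_nat_diff)
            have "(card (explore d A x y) + (m - 1 :: nat) * \<Delta>) * (exp (2 * \<theta>) - 1)
                \<le> (card A + m * \<Delta>) * (exp (2 * \<theta>) - 1)"
              unfolding vertex_step(3)[OF x yU] m1
              by (rule mult_right_mono[OF _ e1]) (use D in \<open>simp add: algebra_simps\<close>)
            moreover have "real (d ?w) * (1 - exp (- \<theta> * (real (d ?w) - 2 + \<kappa>))) \<le> \<Delta>"
            proof -
              have "real (d ?w) * (1 - exp (- \<theta> * (real (d ?w) - 2 + \<kappa>))) \<le> real (d ?w) * 1"
                by (rule mult_left_mono) auto
              then show ?thesis using D by simp
            qed
            moreover have "(m - 1 :: nat) * \<Delta> = m * \<Delta> - \<Delta>" unfolding m1 by (simp add: algebra_simps)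
            ultimately show ?thesis
              using less.prems(3) unfolding sum_U_remove[OF w(1)] by linarith
          qed
          then have "card {M \<in> perfect_matchings (pool - {x, y}). Ev (explore d A x y) (U - {?w}) (m - 1) M}
              \<le> b (explore d A x y) (m - 1) * matching_number (card pool - 2)"
            by (intro IH[OF x y vertex_step(1,2)[OF x yU]]) auto
          moreover have "card {M \<in> perfect_matchings (pool - {x, y}). Ev A U m (insert {x, y} M)}
              \<le> card {M \<in> perfect_matchings (pool - {x, y}). Ev (explore d A x y) (U - {?w}) (m - 1) M}"
            using imp by (intro card_mono fin[OF finp]) blast
          moreover have "b (explore d A x y) (m - 1) = c y"
            using False m
            by (simp add: b_def c_def vertex_step(3)[OF x yU] of_nat_diff algebra_simps flip: exp_add)
          ultimately show ?thesis by simp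
        qed
      qed
    next
      have "(\<Sum>y\<in>pool - {x}. c y) = (\<Sum>y\<in>A - {x}. c y) + (\<Sum>y\<in>stubs d U. c y)"
        using sum_pool_remove[OF x, of c] by simp
      also have "(\<Sum>y\<in>A - {x}. c y) = card (A - {x}) * (b A m * exp (2 * \<theta>))" by (simp add: c_def)
      also have "(\<Sum>y\<in>stubs d U. c y) = (\<Sum>y\<in>stubs d U. b A m * exp (- \<theta> * (real (d (fst y)) - 2 + \<kappa>)))"
        using disjoint_AU by (intro sum.cong) (auto simp: c_def)
      also have "\<dots> = (\<Sum>w\<in>U. d w * (b A m * exp (- \<theta> * (real (d w) - 2 + \<kappa>))))"
        by (rule sum_stubs[OF finite_U, of "\<lambda>w. b A m * exp (- \<theta> * (real (d w) - 2 + \<kappa>))"])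
      also have "\<dots> = (\<Sum>w\<in>U. b A m * d w - b A m * (d w * (1 - exp (- \<theta> * (real (d w) - 2 + \<kappa>)))))"
        by (intro sum.cong refl) (simp add: algebra_simps)
      also have "\<dots> = b A m * (\<Sum>w\<in>U. real (d w))
          - b A m * (\<Sum>w\<in>U. d w * (1 - exp (- \<theta> * (real (d w) - 2 + \<kappa>))))"
        by (simp only: sum_subtractf sum_distrib_left)
      also have "card (A - {x}) * (b A m * exp (2 * \<theta>)) + \<dots> = b A m * (card (A - {x})
          + (\<Sum>w\<in>U. real (d w)) + (card (A - {x}) * (exp (2 * \<theta>) - 1)
          - (\<Sum>w\<in>U. d w * (1 - exp (- \<theta> * (real (d w) - 2 + \<kappa>))))))"
        by (simp add: algebra_simps)
      also have "\<dots> \<le> b A m * (real (card pool) - 1)"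
      proof (rule mult_left_mono[OF _ b0])
        \<comment> \<open>The reverse drift of the undiscovered vertices outweighs the loss from
          partners in A.\<close>
        have "card (A - {x}) \<le> card A" using finite_A by (intro card_mono) auto
        then have "card (A - {x}) * (exp (2 * \<theta>) - 1) \<le> (card A + m * \<Delta>) * (exp (2 * \<theta>) - 1)"
          using assms(4) by (intro mult_right_mono[OF _ e1]) (simp add: add_increasing2)
        moreover have "0 \<le> m * \<Delta>" using assms(4) by simp
        ultimately show "card (A - {x}) + (\<Sum>w\<in>U. real (d w)) + (card (A - {x}) * (exp (2 * \<theta>) - 1)
          - (\<Sum>w\<in>U. d w * (1 - exp (- \<theta> * (real (d w) - 2 + \<kappa>))))) \<le> real (card pool) - 1"
          using less.prems(3) card_pool_remove[OF x] by simp
      qed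
      finally show "(\<Sum>y\<in>pool - {x}. c y) \<le> b A m * (real (card pool) - 1)" .
    qed
  qed
  then show ?case unfolding Ev_def b_def .
qed

section \<open>Components of the configuration model\<close>

definition component_of :: "nat \<Rightarrow> (nat \<times> nat) set set \<Rightarrow> nat \<Rightarrow> nat set" where
  "component_of n M v = {u \<in> {1..n}. (v, u) \<in> (adj (multigraph_of_matching n M))\<^sup>*}"

lemma component_of_subset: "component_of n M v \<subseteq> {1..n}"
  by (auto simp: component_of_def)

lemma finite_component_of [simp]: "finite (component_of n M v)"
  by (rule finite_subset[OF component_of_subset]) simp

lemma mem_component_of: "v \<in> {1..n} \<Longrightarrow> v \<in> component_of n M v"
  by (simp add: component_of_def)

lemma graph_components_multigraph_of_matching:
  "graph_components (multigraph_of_matching n M) = component_of n M ` {1..n}"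
  by (auto simp: graph_components_def component_of_def multigraph_of_matching_def)

lemma half_edges_eq_stubs: "half_edges n d = stubs d {1..n}"
  by (simp add: half_edges_def stubs_def)

text \<open>The multiset of edges forgets which half-edges were joined; this recovers such a pair.
  Loops are included, as distinct half-edges may share their vertex.\<close>

lemma adj_multigraph_of_matching_iff:
  assumes "M \<in> perfect_matchings (half_edges n d)"
  shows "(u, v) \<in> adj (multigraph_of_matching n M) \<longleftrightarrow>
    (\<exists>x y. {x, y} \<in> M \<and> x \<noteq> y \<and> fst x = u \<and> fst y = v)"
proof -
  note D = perfect_matchings_D[OF assms]
  have "finite M" using finite_UnionD[of M] D(1) finite_half_edges[of n d] by simp
  then have adj: "(u, v) \<in> adj (multigraph_of_matching n M) \<longleftrightarrow>
      (\<exists>e\<in>M. image_mset fst (mset_set e) = {#u, v#})"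
    by (auto simp: adj_def multigraph_of_matching_def image_iff eq_commute[of "{#u, v#}"])
  show ?thesis unfolding adj
  proof
    assume "\<exists>e\<in>M. image_mset fst (mset_set e) = {#u, v#}"
    then obtain e where e: "e \<in> M" "image_mset fst (mset_set e) = {#u, v#}" by blast
    then obtain x y where xy: "e = {x, y}" "x \<noteq> y" using D(2) by (metis card_2_iff)
    then have "{#fst x, fst y#} = {#u, v#}" using e(2) by simp
    then have "fst x = u \<and> fst y = v \<or> fst x = v \<and> fst y = u"
      by (auto simp: add_eq_conv_ex)
    then show "\<exists>x y. {x, y} \<in> M \<and> x \<noteq> y \<and> fst x = u \<and> fst y = v"
      using e(1) xy by (metis insert_commute)
  next
    assume "\<exists>x y. {x, y} \<in> M \<and> x \<noteq> y \<and> fst x = u \<and> fst y = v"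
    then obtain x y where xy: "{x, y} \<in> M" "x \<noteq> y" "fst x = u" "fst y = v" by blast
    then have "image_mset fst (mset_set {x, y}) = {#u, v#}" by simp
    then show "\<exists>e\<in>M. image_mset fst (mset_set e) = {#u, v#}" using xy(1) by blast
  qed
qed

text \<open>With \<open>component_of_subset_closed\<close> this identifies the component of a vertex
  v as the least vertex set that contains v and has closed stubs, the form in which components enter
  the counting.\<close>

lemma closed_under_stubs_component_of:
  assumes "M \<in> perfect_matchings (half_edges n d)"
  shows "closed_under M (stubs d (component_of n M v))"
  unfolding closed_under_def
proof
  note D = perfect_matchings_D[OF assms]
  fix e assume e: "e \<in> M"
  then obtain x y where xy: "e = {x, y}" "x \<noteq> y" using D(2) by (metis card_2_iff)
  have step: "b \<in> stubs d (component_of n M v)"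
    if "a \<in> stubs d (component_of n M v)" "{a, b} \<in> M" "a \<noteq> b" for a b
  proof -
    have "(fst a, fst b) \<in> adj (multigraph_of_matching n M)"
      using adj_multigraph_of_matching_iff[OF assms] that(2,3) by blast
    moreover have "b \<in> half_edges n d" using D(1) that(2) by blast
    ultimately show ?thesis
      using that(1) unfolding half_edges_eq_stubs
      by (auto simp: mem_stubs component_of_def intro: rtrancl_into_rtrancl)
  qed
  show "e \<subseteq> stubs d (component_of n M v) \<or> e \<inter> stubs d (component_of n M v) = {}"
    using step[of x y] step[of y x] e xy by (auto simp: insert_commute)
qed

lemma component_of_subset_closed:
  assumes "M \<in> perfect_matchings (half_edges n d)" "closed_under M (stubs d W)" "v \<in> W"
  shows "component_of n M v \<subseteq> W"
proof
  note D = perfect_matchings_D[OF assms(1)]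
  fix u assume "u \<in> component_of n M v"
  then have "(v, u) \<in> (adj (multigraph_of_matching n M))\<^sup>*" by (simp add: component_of_def)
  then show "u \<in> W"
  proof induction
    case base
    show ?case by fact
  next
    case (step u w)
    then obtain x y where xy: "{x, y} \<in> M" "fst x = u" "fst y = w"
      using adj_multigraph_of_matching_iff[OF assms(1)] by blast
    have "x \<in> half_edges n d" using D(1) xy(1) by blast
    then have "x \<in> stubs d W" using step xy by (simp add: half_edges_eq_stubs mem_stubs)
    moreover have "{x, y} \<subseteq> stubs d W \<or> {x, y} \<inter> stubs d W = {}"
      using assms(2)[unfolded closed_under_def, rule_format, OF xy(1)] .
    ultimately have "y \<in> stubs d W" by auto
    then show ?case using xy by (simp add: mem_stubs)
  qed
qed

lemma component_of_eq:
  assumes "v \<in> component_of n M w"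
  shows "component_of n M v = component_of n M w"
proof -
  let ?R = "(adj (multigraph_of_matching n M))\<^sup>*"
  have "sym (adj (multigraph_of_matching n M))"
    by (rule symI) (simp add: adj_def add_mset_commute)
  then have "sym ?R" by (rule sym_rtrancl)
  moreover have "(w, v) \<in> ?R" using assms by (simp add: component_of_def)
  ultimately have "(w, v) \<in> ?R" "(v, w) \<in> ?R" by (auto dest: symD)
  then show ?thesis unfolding component_of_def by (auto intro: rtrancl_trans)
qed

section \<open>Explorations started at a vertex\<close>

lemma exploration_vertex:
  assumes "v \<in> {1..n}" "S \<subseteq> {1..n}"
  shows "exploration d (stubs d {v}) (stubs d ({1..n} - S - {v})) (S - {v})"
    and "stubs d {v} \<union> stubs d (S - {v}) \<union> stubs d ({1..n} - S - {v}) = half_edges n d"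
proof -
  have "finite S" using assms(2) finite_subset by blast
  then show "exploration d (stubs d {v}) (stubs d ({1..n} - S - {v})) (S - {v})"
    by unfold_locales (auto simp: mem_stubs)
  show "stubs d {v} \<union> stubs d (S - {v}) \<union> stubs d ({1..n} - S - {v}) = half_edges n d"
    using assms unfolding half_edges_eq_stubs by (auto simp: mem_stubs)
qed

text \<open>A component with more than m vertices either lies in S, and is explored from one of its
  vertices without a hit, or contains a vertex outside S, from which it is explored with hits
  allowed. Only the second kind costs \<beta>, weighted by the degrees outside S; the exponential
  term occurs at most 2 n times.\<close>

lemma card_large_component_le:
  fixes \<theta> \<kappa> \<beta> \<Delta> :: real and m :: nat
  assumes \<theta>: "0 \<le> \<theta>" and \<kappa>: "0 \<le> \<kappa>" "\<kappa> \<le> 1" and \<beta>: "0 \<le> \<beta>" and S: "S \<subseteq> {1..n}"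
    and \<Delta>: "\<And>w. w \<in> {1..n} \<Longrightarrow> real (d w) \<le> \<Delta>"
    and drift: "(\<Sum>w\<in>S. d w * (exp (\<theta> * (real (d w) - 2 + \<kappa>)) - 1)) + (m + 1) * \<theta> \<le> 0"
    and big: "(\<Sum>w\<in>{1..n} - S. real (d w)) + \<beta> * ((\<Sum>w\<in>S. d w * (real (d w) - 2)) + (m + 1)) \<le> 0"
  shows "card {M \<in> perfect_matchings (half_edges n d). \<exists>v\<in>{1..n}. m < card (component_of n M v)}
    \<le> (2 * real n * exp (\<theta> * (\<Delta> - \<kappa> * m)) + \<beta> * (\<Sum>w\<in>{1..n} - S. real (d w)))
        * matching_number (card (half_edges n d))"
proof -
  let ?P = "perfect_matchings (half_edges n d)" and ?N = "real (matching_number (card (half_edges n d)))"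
  let ?e = "exp (\<theta> * (\<Delta> - \<kappa> * m))"
  have finS: "finite S" using S finite_subset by blast
  have finP: "finite {M \<in> ?P. Q M}" for Q
    using finite_perfect_matchings[OF finite_half_edges[of n d]] by simp
  define T where "T hit v = {M \<in> ?P. (hit \<or> (\<exists>W\<subseteq>S - {v}. closed_under M (stubs d {v} \<union> stubs d W))) \<and>
      (\<forall>W\<subseteq>S - {v}. closed_under M (stubs d {v} \<union> stubs d W) \<longrightarrow> m \<le> card W)}" for hit v
  \<comment> \<open>The starting vertex is deleted from the sums as well; this consumes the extra
    unit in m + 1.\<close>
  have sum_le: "(\<Sum>w\<in>S - {v}. g w) + m * t \<le> (\<Sum>w\<in>S. g w) + (m + 1) * t"
    if "\<And>w. - t \<le> g w" "0 \<le> t" for g :: "nat \<Rightarrow> real" and t :: real and v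
    using that(1)[of v] that(2) finS by (cases "v \<in> S") (simp_all add: sum_diff1 algebra_simps)
  have drift_v: "(\<Sum>w\<in>S - {v}. d w * (exp (\<theta> * (real (d w) - 2 + \<kappa>)) - 1)) + m * \<theta> \<le> 0" for v
    using sum_le[where t = \<theta> and v = v and g = "\<lambda>w. d w * (exp (\<theta> * (real (d w) - 2 + \<kappa>)) - 1)"] drift \<theta> \<kappa>
    by (force intro: exp_drift_ge)
  have e: "exp (\<theta> * (card (stubs d {v}) - \<kappa> * m)) \<le> ?e" if "v \<in> {1..n}" for v
    using \<Delta>[OF that] \<theta> by (simp add: card_stubs mult_left_mono)
  have T_False: "card (T False v) \<le> ?e * ?N" if v: "v \<in> {1..n}" for v
  proof -
    have "card (T False v) \<le> exp (\<theta> * (card (stubs d {v}) - \<kappa> * m)) * ?N"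
      \<comment> \<open>Here \<open>order_refl\<close> instantiates \<beta> to 0, so that only the
        exponential term remains.\<close>
      using card_long_exploration_le[OF exploration_vertex(1)[OF v S] \<theta> \<kappa> order_refl drift_v, of False]
      unfolding exploration_vertex(2)[OF v S] T_def by simp
    also have "\<dots> \<le> ?e * ?N" by (rule mult_right_mono[OF e[OF v]]) simp
    finally show ?thesis .
  qed
  have T_True: "card (T True v) \<le> (?e + \<beta> * d v) * ?N" if v: "v \<in> {1..n}" for v
  proof -
    have "card (stubs d ({1..n} - S - {v})) \<le> (\<Sum>w\<in>{1..n} - S. d w)"
      unfolding card_stubs[OF finite_Diff[OF finite_Diff[OF finite_atLeastAtMost]]]
      by (rule sum_mono2) auto
    then have "real (card (stubs d ({1..n} - S - {v}))) \<le> (\<Sum>w\<in>{1..n} - S. real (d w))"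
      unfolding of_nat_sum[symmetric] of_nat_le_iff .
    moreover have "(\<Sum>w\<in>S - {v}. d w * (real (d w) - 2)) + m * (1 :: real)
        \<le> (\<Sum>w\<in>S. d w * (real (d w) - 2)) + (m + 1) * (1 :: real)"
    proof (rule sum_le)
      fix w
      have "0 \<le> (real (d w) - 1)\<^sup>2" by simp
      then show "- 1 \<le> real (d w) * (real (d w) - 2)" by (simp add: power2_eq_square algebra_simps)
    qed simp
    then have "\<beta> * ((\<Sum>w\<in>S - {v}. d w * (real (d w) - 2)) + m)
        \<le> \<beta> * ((\<Sum>w\<in>S. d w * (real (d w) - 2)) + (m + 1))"
      by (intro mult_left_mono[OF _ \<beta>]) simp
    ultimately have "card (T True v) \<le> (exp (\<theta> * (card (stubs d {v}) - \<kappa> * m)) + \<beta> * card (stubs d {v})) * ?N"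
      using card_long_exploration_le[OF exploration_vertex(1)[OF v S] \<theta> \<kappa> \<beta> drift_v, of True] big
      unfolding exploration_vertex(2)[OF v S] T_def by simp
    also have "\<dots> \<le> (?e + \<beta> * d v) * ?N"
      using e[OF v] by (intro mult_right_mono add_mono) (auto simp: card_stubs)
    finally show ?thesis .
  qed
  have "{M \<in> ?P. \<exists>v\<in>{1..n}. m < card (component_of n M v)}
      \<subseteq> (\<Union>v\<in>{1..n}. T False v) \<union> (\<Union>v\<in>{1..n} - S. T True v)"
  proof
    fix M assume "M \<in> {M \<in> ?P. \<exists>v\<in>{1..n}. m < card (component_of n M v)}"
    then obtain w where M: "M \<in> ?P" and w: "w \<in> {1..n}" "m < card (component_of n M w)" by blast
    \<comment> \<open>Any vertex v of the component may serve as the start. Since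
      \<open>insert v W\<close> contains the component, the strict inequality for its size leaves m
      for W.\<close>
    have le: "m \<le> card W"
      if v: "v \<in> component_of n M w" and W: "W \<subseteq> S - {v}" "closed_under M (stubs d {v} \<union> stubs d W)" for v W
    proof -
      have "closed_under M (stubs d (insert v W))" using W(2) by (simp add: stubs_insert[of d v W])
      then have "component_of n M w \<subseteq> insert v W"
        using component_of_subset_closed[OF M] component_of_eq[OF v] by blast
      moreover have "finite W" using W(1) finS finite_subset by blast
      ultimately have "card (component_of n M w) \<le> card (insert v W)" by (intro card_mono) auto
      also have "\<dots> \<le> Suc (card W)" by (rule card_insert_le_m1) auto
      finally show ?thesis using w(2) by simp
    qed
    show "M \<in> (\<Union>v\<in>{1..n}. T False v) \<union> (\<Union>v\<in>{1..n} - S. T True v)"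
    proof (cases "component_of n M w \<subseteq> S")
      case True
      let ?W = "component_of n M w - {w}"
      have "insert w (component_of n M w) = component_of n M w" using mem_component_of[OF w(1)] by blast
      then have "stubs d {w} \<union> stubs d ?W = stubs d (component_of n M w)"
        using stubs_insert[of d w ?W] by simp
      then have "closed_under M (stubs d {w} \<union> stubs d ?W)"
        using closed_under_stubs_component_of[OF M] by simp
      moreover have "?W \<subseteq> S - {w}" using True by blast
      ultimately have "M \<in> T False w"
        unfolding T_def using M le[OF mem_component_of[OF w(1)]] by blast
      then show ?thesis using w(1) by blast
    next
      case False
      then obtain v where v: "v \<in> component_of n M w" "v \<notin> S" by blast
      then have "M \<in> T True v" unfolding T_def using M le[OF v(1)] by blast
      then show ?thesis using v component_of_subset[of n M w] by blast
    qed
  qed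
  then have "card {M \<in> ?P. \<exists>v\<in>{1..n}. m < card (component_of n M v)}
      \<le> card ((\<Union>v\<in>{1..n}. T False v) \<union> (\<Union>v\<in>{1..n} - S. T True v))"
    by (rule card_mono[rotated]) (auto simp: T_def intro: finP)
  also have "\<dots> \<le> card (\<Union>v\<in>{1..n}. T False v) + card (\<Union>v\<in>{1..n} - S. T True v)"
    by (rule card_Un_le)
  also have "\<dots> \<le> (\<Sum>v\<in>{1..n}. card (T False v)) + (\<Sum>v\<in>{1..n} - S. card (T True v))"
    by (intro add_mono card_UN_le) auto
  finally have "real (card {M \<in> ?P. \<exists>v\<in>{1..n}. m < card (component_of n M v)})
      \<le> (\<Sum>v\<in>{1..n}. real (card (T False v))) + (\<Sum>v\<in>{1..n} - S. real (card (T True v)))"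
    unfolding of_nat_sum[symmetric] of_nat_add[symmetric] of_nat_le_iff .
  also have "\<dots> \<le> (\<Sum>v\<in>{1..n}. ?e * ?N) + (\<Sum>v\<in>{1..n} - S. (?e + \<beta> * d v) * ?N)"
    using T_False T_True by (intro add_mono sum_mono) auto
  also have "\<dots> = (n * ?e + card ({1..n} - S) * ?e + \<beta> * (\<Sum>w\<in>{1..n} - S. real (d w))) * ?N"
    by (simp add: sum.distrib sum_distrib_left sum_distrib_right algebra_simps)
  also have "\<dots> \<le> (2 * real n * ?e + \<beta> * (\<Sum>w\<in>{1..n} - S. real (d w))) * ?N"
  proof (rule mult_right_mono)
    have "card ({1..n} - S) \<le> n" using card_mono[of "{1..n}" "{1..n} - S"] by simp
    then have "card ({1..n} - S) * ?e \<le> n * ?e" by (intro mult_right_mono) auto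
    then show "n * ?e + card ({1..n} - S) * ?e + \<beta> * (\<Sum>w\<in>{1..n} - S. real (d w))
        \<le> 2 * real n * ?e + \<beta> * (\<Sum>w\<in>{1..n} - S. real (d w))" by simp
  qed simp
  finally show ?thesis .
qed

text \<open>Explores from v with no forbidden half-edges: a component of at most m vertices, less v,
  is a W as in \<open>card_short_exploration_le\<close>. The extra \<Delta> in (m + 1) * \<Delta>
  pays for deleting v from the drift sum.\<close>

lemma card_small_component_le:
  fixes \<theta> \<kappa> \<Delta> :: real and m :: nat
  assumes "0 \<le> \<theta>" "0 \<le> \<kappa>" "v \<in> {1..n}"
    and \<Delta>: "\<And>w. w \<in> {1..n} \<Longrightarrow> real (d w) \<le> \<Delta>"
    and drift: "(d v + m * \<Delta>) * (exp (2 * \<theta>) - 1) + (m + 1) * \<Delta>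
      \<le> (\<Sum>w\<in>{1..n}. d w * (1 - exp (- \<theta> * (real (d w) - 2 + \<kappa>))))"
  shows "card {M \<in> perfect_matchings (half_edges n d). card (component_of n M v) \<le> m}
    \<le> exp (\<theta> * (\<kappa> * m - d v)) * matching_number (card (half_edges n d))"
proof -
  let ?P = "perfect_matchings (half_edges n d)" and ?U = "{1..n} - {v}"
  have H: "stubs d {v} \<union> stubs d ?U \<union> {} = half_edges n d" and ex: "exploration d (stubs d {v}) {} ?U"
    using exploration_vertex[OF assms(3), of "{1..n}" d] by simp_all
  have "real (d v) * (1 - exp (- \<theta> * (real (d v) - 2 + \<kappa>))) \<le> real (d v) * 1"
    by (rule mult_left_mono) auto
  then have "real (d v) * (1 - exp (- \<theta> * (real (d v) - 2 + \<kappa>))) \<le> \<Delta>" using \<Delta>[OF assms(3)] by simp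
  then have "(card (stubs d {v}) + m * \<Delta>) * (exp (2 * \<theta>) - 1) + m * \<Delta>
      \<le> (\<Sum>w\<in>?U. d w * (1 - exp (- \<theta> * (real (d w) - 2 + \<kappa>))))"
    using drift assms(3) by (simp add: sum_diff1 card_stubs algebra_simps)
  moreover have "0 \<le> \<Delta>" using \<Delta>[OF assms(3)] of_nat_0_le_iff order_trans by blast
  ultimately have "card {M \<in> ?P. \<exists>W\<subseteq>?U. card W \<le> m \<and> closed_under M (stubs d {v} \<union> stubs d W)}
      \<le> exp (\<theta> * (\<kappa> * m - d v)) * matching_number (card (half_edges n d))"
    using card_short_exploration_le[OF ex assms(1,2), of \<Delta> m] \<Delta> unfolding H by (simp add: card_stubs)
  moreover have "card {M \<in> ?P. card (component_of n M v) \<le> m}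
      \<le> card {M \<in> ?P. \<exists>W\<subseteq>?U. card W \<le> m \<and> closed_under M (stubs d {v} \<union> stubs d W)}"
  proof (rule card_mono)
    show "finite {M \<in> ?P. \<exists>W\<subseteq>?U. card W \<le> m \<and> closed_under M (stubs d {v} \<union> stubs d W)}"
      using finite_perfect_matchings[OF finite_half_edges[of n d]] by simp
    show "{M \<in> ?P. card (component_of n M v) \<le> m}
        \<subseteq> {M \<in> ?P. \<exists>W\<subseteq>?U. card W \<le> m \<and> closed_under M (stubs d {v} \<union> stubs d W)}"
    proof (clarify, intro exI conjI)
      fix M assume M: "M \<in> ?P" "card (component_of n M v) \<le> m"
      let ?W = "component_of n M v - {v}"
      have "insert v (component_of n M v) = component_of n M v" using mem_component_of[OF assms(3)] by blast
      then have "stubs d {v} \<union> stubs d ?W = stubs d (component_of n M v)"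
        using stubs_insert[of d v ?W] by simp
      then show "closed_under M (stubs d {v} \<union> stubs d ?W)"
        using closed_under_stubs_component_of[OF M(1)] by simp
      show "card ?W \<le> m" using M(2) card_Diff1_le[of "component_of n M v" v] by linarith
      show "?W \<subseteq> ?U" using component_of_subset[of n M v] by blast
    qed
  qed
  ultimately show ?thesis by linarith
qed

section \<open>Independent degrees\<close>

lemma indep_vars_iid_degrees:
  fixes f :: "nat \<Rightarrow> real"
  shows "prob_space.indep_vars (measure_pmf (iid_degrees D n)) (\<lambda>_. borel) (\<lambda>i d. f (d i)) {1..n}"
  unfolding iid_degrees_def
  by (rule prob_space.indep_vars_compose2[OF measure_pmf.prob_space_axioms indep_vars_Pi_pmf]) auto

lemma map_pmf_iid_degrees: "i \<in> {1..n} \<Longrightarrow> map_pmf (\<lambda>d. d i) (iid_degrees D n) = D"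
  by (simp add: iid_degrees_def Pi_pmf_component)

lemma expectation_iid_degrees:
  fixes f :: "nat \<Rightarrow> real"
  assumes "i \<in> {1..n}"
  shows "measure_pmf.expectation (iid_degrees D n) (\<lambda>d. f (d i)) = measure_pmf.expectation D f"
proof -
  have "measure_pmf.expectation D f = measure_pmf.expectation (map_pmf (\<lambda>d. d i) (iid_degrees D n)) f"
    by (simp only: map_pmf_iid_degrees[OF assms])
  then show ?thesis by simp
qed

lemma integrable_iid_degrees:
  fixes f :: "nat \<Rightarrow> real"
  assumes "i \<in> {1..n}" "integrable (measure_pmf D) f"
  shows "integrable (measure_pmf (iid_degrees D n)) (\<lambda>d. f (d i))"
proof -
  have "integrable (measure_pmf (map_pmf (\<lambda>d. d i) (iid_degrees D n))) f"
    unfolding map_pmf_iid_degrees[OF assms(1)] by fact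
  then show ?thesis by simp
qed

lemma prob_iid_degrees_component:
  assumes "i \<in> {1..n}"
  shows "measure_pmf.prob (iid_degrees D n) {d. d i \<in> X} = measure_pmf.prob D X"
proof -
  have "measure_pmf.prob D X = measure_pmf.prob (map_pmf (\<lambda>d. d i) (iid_degrees D n)) X"
    by (simp only: map_pmf_iid_degrees[OF assms])
  then show ?thesis by (simp add: vimage_def)
qed

section \<open>Concentration of sums over the vertices\<close>

lemma second_moment_iid_degrees_sum:
  fixes f :: "nat \<Rightarrow> real"
  assumes f2: "integrable (measure_pmf D) (\<lambda>k. (f k)\<^sup>2)" and f1: "integrable (measure_pmf D) f"
    and f0: "measure_pmf.expectation D f = 0"
  shows "integrable (measure_pmf (iid_degrees D n)) (\<lambda>d. (\<Sum>i=1..n. f (d i))\<^sup>2)"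
    and "measure_pmf.expectation (iid_degrees D n) (\<lambda>d. (\<Sum>i=1..n. f (d i))\<^sup>2)
      = n * measure_pmf.expectation D (\<lambda>k. (f k)\<^sup>2)"
proof -
  let ?P = "measure_pmf (iid_degrees D n)"
  have sq: "(\<Sum>i=1..n. f (d i))\<^sup>2 = (\<Sum>i=1..n. \<Sum>j=1..n. f (d i) * f (d j))" for d
    by (simp add: power2_eq_square sum_product)
  have ij: "integrable ?P (\<lambda>d. f (d i) * f (d j)) \<and>
      (\<integral>d. f (d i) * f (d j) \<partial>?P) = (if i = j then measure_pmf.expectation D (\<lambda>k. (f k)\<^sup>2) else 0)"
    if "i \<in> {1..n}" "j \<in> {1..n}" for i j
  proof (cases "i = j")
    case True
    then show ?thesis
      using integrable_iid_degrees[OF that(1) f2] expectation_iid_degrees[OF that(1), of D "\<lambda>k. (f k)\<^sup>2"]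
      by (simp add: power2_eq_square)
  next
    case False
    \<comment> \<open>Independence of two coordinates is obtained as independence from a sum with
      the single index j.\<close>
    have ind: "prob_space.indep_var ?P borel (\<lambda>d. f (d i)) borel (\<lambda>d. f (d j))"
      using prob_space.indep_vars_sum[OF measure_pmf.prob_space_axioms, of "{j}" i "iid_degrees D n" "\<lambda>i d. f (d i)"]
        prob_space.indep_vars_subset[OF measure_pmf.prob_space_axioms indep_vars_iid_degrees, of "{i, j}" n D f] that False
      by simp
    note int = integrable_iid_degrees[OF that(1) f1] integrable_iid_degrees[OF that(2) f1]
    show ?thesis
      using prob_space.indep_var_integrable[OF measure_pmf.prob_space_axioms ind int]
        prob_space.indep_var_lebesgue_integral[OF measure_pmf.prob_space_axioms ind int] False
      by (simp add: expectation_iid_degrees[OF that(1)] f0)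
  qed
  show "integrable ?P (\<lambda>d. (\<Sum>i=1..n. f (d i))\<^sup>2)"
    unfolding sq using ij by (intro Bochner_Integration.integrable_sum) auto
  have "(\<integral>d. (\<Sum>i=1..n. f (d i))\<^sup>2 \<partial>?P) = (\<Sum>i=1..n. \<Sum>j=1..n. \<integral>d. f (d i) * f (d j) \<partial>?P)"
    unfolding sq using ij by (subst Bochner_Integration.integral_sum)
      (auto intro!: Bochner_Integration.integrable_sum sum.cong Bochner_Integration.integral_sum)
  also have "\<dots> = (\<Sum>i=1..n. \<Sum>j=1..n. if i = j then measure_pmf.expectation D (\<lambda>k. (f k)\<^sup>2) else 0)"
    using ij by (intro sum.cong) auto
  finally show "(\<integral>d. (\<Sum>i=1..n. f (d i))\<^sup>2 \<partial>?P) = n * measure_pmf.expectation D (\<lambda>k. (f k)\<^sup>2)"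
    by simp
qed

lemma prob_iid_degrees_sum_deviation_le:
  fixes f :: "nat \<Rightarrow> real"
  assumes f2: "integrable (measure_pmf D) (\<lambda>k. (f k)\<^sup>2)" and "a > 0"
  shows "measure_pmf.prob (iid_degrees D n)
      {d. a \<le> \<bar>(\<Sum>i=1..n. f (d i)) - n * measure_pmf.expectation D f\<bar>}
    \<le> n * measure_pmf.expectation D (\<lambda>k. (f k)\<^sup>2) / a\<^sup>2"
proof -
  let ?P = "measure_pmf (iid_degrees D n)" and ?\<mu> = "measure_pmf.expectation D f"
  define g where "g k = f k - ?\<mu>" for k
  have f1: "integrable (measure_pmf D) f"
    using measure_pmf.square_integrable_imp_integrable[OF _ f2] by simp
  have g2: "integrable (measure_pmf D) (\<lambda>k. (g k)\<^sup>2)"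
    unfolding g_def power2_diff using f1 f2 by simp
  have g1: "integrable (measure_pmf D) g" unfolding g_def using f1 by simp
  have g0: "measure_pmf.expectation D g = 0" unfolding g_def using f1 by simp
  have le: "measure_pmf.expectation D (\<lambda>k. (g k)\<^sup>2) \<le> measure_pmf.expectation D (\<lambda>k. (f k)\<^sup>2)"
    unfolding g_def using measure_pmf.variance_eq[OF f1 f2] by simp
  note sm = second_moment_iid_degrees_sum[OF g2 g1 g0, of n]
  have "(\<Sum>i=1..n. f (d i)) - n * ?\<mu> = (\<Sum>i=1..n. g (d i))" for d :: "nat \<Rightarrow> nat"
    by (simp add: g_def sum_subtractf)
  then have "measure_pmf.prob (iid_degrees D n) {d. a \<le> \<bar>(\<Sum>i=1..n. f (d i)) - n * ?\<mu>\<bar>}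
      = measure ?P {d \<in> space ?P. a \<le> \<bar>\<Sum>i=1..n. g (d i)\<bar>}" by simp
  also have "\<dots> \<le> (\<integral>d. (\<Sum>i=1..n. g (d i))\<^sup>2 \<partial>?P) / a\<^sup>2"
    by (rule measure_pmf.second_moment_method) (use sm \<open>a > 0\<close> in auto)
  also have "\<dots> \<le> n * measure_pmf.expectation D (\<lambda>k. (f k)\<^sup>2) / a\<^sup>2"
    unfolding sm(2) by (intro divide_right_mono mult_left_mono le) auto
  finally show ?thesis .
qed

text \<open>Dominated convergence with majorant C k^2 handles the means. For the fluctuation, the
  bound linear in k keeps the second moment of \<open>g n\<close> below \<open>(s n)\<^sup>2\<close>
  times that of D, so that Chebyshev's inequality works with only two moments of D.\<close>

lemma prob_iid_degrees_average_tendsto: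
  fixes g :: "nat \<Rightarrow> nat \<Rightarrow> real" and G :: "nat \<Rightarrow> real" and s :: "nat \<Rightarrow> real" and C \<epsilon> :: real
  assumes D2: "integrable (measure_pmf D) (\<lambda>k. (real k)\<^sup>2)"
    and gC: "\<And>n k. \<bar>g n k\<bar> \<le> C * (real k)\<^sup>2" and gs: "\<And>n k. \<bar>g n k\<bar> \<le> s n * real k"
    and s: "(\<lambda>n. (s n)\<^sup>2 / n) \<longlonglongrightarrow> 0" and G: "\<And>k. (\<lambda>n. g n k) \<longlonglongrightarrow> G k" and "\<epsilon> > 0"
  shows "(\<lambda>n. measure_pmf.prob (iid_degrees D n)
      {d. \<epsilon> * n \<le> \<bar>(\<Sum>i=1..n. g n (d i)) - n * measure_pmf.expectation D G\<bar>}) \<longlonglongrightarrow> 0"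
proof -
  define M where "M = measure_pmf.expectation D (\<lambda>k. (real k)\<^sup>2)"
  have "(\<lambda>n. measure_pmf.expectation D (g n)) \<longlonglongrightarrow> measure_pmf.expectation D G"
  proof (rule integral_dominated_convergence[where w = "\<lambda>k. C * (real k)\<^sup>2"])
    show "integrable (measure_pmf D) (\<lambda>k. C * (real k)\<^sup>2)" using D2 by simp
  qed (use gC G in auto)
  \<comment> \<open>Half of \<epsilon> is spent on the bias of the mean and half on the fluctuation;
    hence the factor 4 below.\<close>
  then have "eventually (\<lambda>n. dist (measure_pmf.expectation D (g n)) (measure_pmf.expectation D G) < \<epsilon> / 2) sequentially"
    using \<open>\<epsilon> > 0\<close> by (intro tendstoD) auto
  then have ev: "eventually (\<lambda>n. measure_pmf.prob (iid_degrees D n)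
      {d. \<epsilon> * n \<le> \<bar>(\<Sum>i=1..n. g n (d i)) - n * measure_pmf.expectation D G\<bar>}
      \<le> 4 * M / \<epsilon>\<^sup>2 * ((s n)\<^sup>2 / n)) sequentially"
    using eventually_gt_at_top[of 0]
  proof eventually_elim
    case (elim n)
    let ?e = "measure_pmf.expectation D (g n)" and ?E = "measure_pmf.expectation D G"
    have sq: "(g n k)\<^sup>2 \<le> (s n)\<^sup>2 * (real k)\<^sup>2" for k
      using power_mono[OF gs[of n k], of 2] by (simp add: power_mult_distrib)
    have g2: "integrable (measure_pmf D) (\<lambda>k. (g n k)\<^sup>2)"
      by (rule Bochner_Integration.integrable_bound[of _ "\<lambda>k. (s n)\<^sup>2 * (real k)\<^sup>2"])
        (use D2 sq in auto)
    have "measure_pmf.expectation D (\<lambda>k. (g n k)\<^sup>2) \<le> measure_pmf.expectation D (\<lambda>k. (s n)\<^sup>2 * (real k)\<^sup>2)"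
      by (rule integral_mono[OF g2]) (use D2 sq in auto)
    then have M: "measure_pmf.expectation D (\<lambda>k. (g n k)\<^sup>2) \<le> (s n)\<^sup>2 * M" by (simp add: M_def)
    have "n * \<bar>?e - ?E\<bar> \<le> n * (\<epsilon> / 2)" using elim by (intro mult_left_mono) (auto simp: dist_real_def)
    then have close: "\<bar>n * ?e - n * ?E\<bar> \<le> \<epsilon> * n / 2"
      by (simp add: abs_mult mult.commute flip: right_diff_distrib)
    have "\<epsilon> / 2 * n \<le> \<bar>x - n * ?e\<bar>" if "\<epsilon> * n \<le> \<bar>x - n * ?E\<bar>" for x
      using abs_triangle_ineq[of "x - n * ?e" "n * ?e - n * ?E"] close that by simp
    then have "measure_pmf.prob (iid_degrees D n) {d. \<epsilon> * n \<le> \<bar>(\<Sum>i=1..n. g n (d i)) - n * ?E\<bar>}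
        \<le> measure_pmf.prob (iid_degrees D n) {d. \<epsilon> / 2 * n \<le> \<bar>(\<Sum>i=1..n. g n (d i)) - n * ?e\<bar>}"
      by (intro measure_pmf.finite_measure_mono) auto
    also have "\<dots> \<le> n * measure_pmf.expectation D (\<lambda>k. (g n k)\<^sup>2) / (\<epsilon> / 2 * n)\<^sup>2"
      by (rule prob_iid_degrees_sum_deviation_le[OF g2]) (use \<open>\<epsilon> > 0\<close> elim in simp)
    also have "\<dots> \<le> n * ((s n)\<^sup>2 * M) / (\<epsilon> / 2 * n)\<^sup>2"
      by (intro divide_right_mono mult_left_mono M) auto
    also have "\<dots> = 4 * M / \<epsilon>\<^sup>2 * ((s n)\<^sup>2 / n)"
      using \<open>\<epsilon> > 0\<close> elim by (simp add: field_simps power2_eq_square)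
    finally show ?case .
  qed
  have "(\<lambda>n. 4 * M / \<epsilon>\<^sup>2 * ((s n)\<^sup>2 / n)) \<longlonglongrightarrow> 0" using tendsto_mult_right_zero[OF s] .
  from tendsto_sandwich[OF _ ev tendsto_const this] show ?thesis by simp
qed

section \<open>Maximum degree and number of big vertices\<close>

lemma prob_iid_degrees_max_le:
  "measure_pmf.prob (iid_degrees D n) {d. \<exists>i\<in>{1..n}. d i \<in> X} \<le> n * measure_pmf.prob D X"
proof -
  have "{d. \<exists>i\<in>{1..n}. d i \<in> X} = (\<Union>i\<in>{1..n}. {d. d i \<in> X})" by auto
  also have "measure_pmf.prob (iid_degrees D n) \<dots> \<le> (\<Sum>i\<in>{1..n}. measure_pmf.prob (iid_degrees D n) {d. d i \<in> X})"
    by (rule measure_pmf.finite_measure_subadditive_finite) auto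
  also have "\<dots> = n * measure_pmf.prob D X" by (simp add: prob_iid_degrees_component)
  finally show ?thesis .
qed

lemma prob_iid_degrees_count_le:
  assumes "J > 0"
  shows "measure_pmf.prob (iid_degrees D n) {d. J \<le> real (card {i\<in>{1..n}. d i \<in> X})}
    \<le> n * measure_pmf.prob D X / J"
proof -
  let ?P = "measure_pmf (iid_degrees D n)" and ?f = "\<lambda>k. indicator X k :: real"
  have eq: "real (card {i\<in>{1..n}. d i \<in> X}) = (\<Sum>i=1..n. ?f (d i))" for d :: "nat \<Rightarrow> nat"
    by (simp add: indicator_def sum.If_cases Int_def conj_assoc)
  have f: "integrable (measure_pmf D) ?f"
    by (rule measure_pmf.integrable_const_bound[of _ 1]) auto
  have int: "integrable ?P (\<lambda>d. \<Sum>i=1..n. ?f (d i))"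
    using integrable_iid_degrees[OF _ f] by (intro Bochner_Integration.integrable_sum) auto
  have "measure ?P {d \<in> space ?P. J \<le> (\<Sum>i=1..n. ?f (d i))} \<le> (\<integral>d. (\<Sum>i=1..n. ?f (d i)) \<partial>?P) / J"
    by (rule integral_Markov_inequality_measure[OF int, of "{}"]) (use assms in \<open>auto intro!: sum_nonneg\<close>)
  also have "(\<integral>d. (\<Sum>i=1..n. ?f (d i)) \<partial>?P) = (\<Sum>i=1..n. \<integral>d. ?f (d i) \<partial>?P)"
    by (rule Bochner_Integration.integral_sum) (use integrable_iid_degrees[OF _ f] in auto)
  also have "\<dots> = (\<Sum>i=1..n. measure_pmf.prob D X)"
    by (intro sum.cong refl) (simp only: expectation_iid_degrees, simp)
  finally show ?thesis unfolding eq by simp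
qed

section \<open>Parity of the degree sum\<close>

lemma prob_even_sum:
  "measure_pmf.prob (iid_degrees D n) (even_sum n)
    = (1 + measure_pmf.expectation D (\<lambda>k. (- 1) ^ k) ^ n) / 2"
proof -
  let ?P = "measure_pmf (iid_degrees D n)" and ?f = "\<lambda>k :: nat. (- 1 :: real) ^ k"
  have f: "integrable (measure_pmf D) ?f"
    by (rule measure_pmf.integrable_const_bound[of _ 1]) (auto simp: power_abs)
  note iv = prob_space.indep_vars_lebesgue_integral[OF measure_pmf.prob_space_axioms _ indep_vars_iid_degrees]
    prob_space.indep_vars_integrable[OF measure_pmf.prob_space_axioms _ indep_vars_iid_degrees]
  have int: "integrable ?P (\<lambda>d. \<Prod>i=1..n. ?f (d i))"
    by (rule iv(2)) (use integrable_iid_degrees[OF _ f] in auto)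
  have "measure_pmf.prob (iid_degrees D n) (even_sum n) = (\<integral>d. indicator (even_sum n) d \<partial>?P)" by simp
  \<comment> \<open>Evenness of a sum s is detected by (1 + (-1)^s) / 2, and (-1)^s is a product
    over the independent degrees.\<close>
  also have "\<dots> = (\<integral>d. (1 + (\<Prod>i=1..n. ?f (d i))) / 2 \<partial>?P)"
    by (intro Bochner_Integration.integral_cong refl)
      (auto simp: indicator_def even_sum_def simp flip: power_sum)
  also have "\<dots> = (1 + (\<integral>d. (\<Prod>i=1..n. ?f (d i)) \<partial>?P)) / 2" using int by simp
  also have "(\<integral>d. (\<Prod>i=1..n. ?f (d i)) \<partial>?P) = (\<Prod>i=1..n. \<integral>d. ?f (d i) \<partial>?P)"
    by (rule iv(1)) (use integrable_iid_degrees[OF _ f] in auto)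
  also have "\<dots> = measure_pmf.expectation D ?f ^ n" by (simp add: expectation_iid_degrees)
  finally show ?thesis .
qed

text \<open>Let r be the expectation of (-1)^D. If \<bar>r\<bar> < 1, its powers stay away from -1.
  If r = 1 the probability is 1. If r = -1, then D is almost surely odd, admissible n are even, and
  the probability is again 1. So conditioning costs at most a factor 1 / p, uniformly in n.\<close>

lemma prob_even_sum_bounded_below:
  obtains p where "p > 0" "\<And>n. n \<in> admissible D \<Longrightarrow> p \<le> measure_pmf.prob (iid_degrees D n) (even_sum n)"
proof -
  define r where "r = measure_pmf.expectation D (\<lambda>k. (- 1 :: real) ^ k)"
  have f: "integrable (measure_pmf D) (\<lambda>k. (- 1 :: real) ^ k)"
    by (rule measure_pmf.integrable_const_bound[of _ 1]) (auto simp: power_abs)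
  have "r \<le> measure_pmf.expectation D (\<lambda>_. 1)"
    unfolding r_def by (rule integral_mono[OF f]) (auto simp: minus_one_power_iff)
  moreover have "measure_pmf.expectation D (\<lambda>_. - 1) \<le> r"
    unfolding r_def by (rule integral_mono[OF _ f]) (auto simp: minus_one_power_iff)
  ultimately have r: "- 1 \<le> r" "r \<le> 1" by auto
  consider "r = - 1" | "r = 1" | "\<bar>r\<bar> < 1" using r by linarith
  then show thesis
  proof cases
    case 1
    show thesis
    proof (rule that[of 1])
      fix n assume "n \<in> admissible D"
      then have "0 < (1 + (- 1 :: real) ^ n) / 2"
        using 1 unfolding admissible_def prob_even_sum r_def[symmetric] by simp
      then have "even n" by (cases "even n") auto
      then show "1 \<le> measure_pmf.prob (iid_degrees D n) (even_sum n)"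
        using 1 unfolding prob_even_sum r_def[symmetric] by simp
    qed simp
  next
    case 2
    show thesis by (rule that[of 1]) (use 2 in \<open>auto simp: prob_even_sum r_def[symmetric]\<close>)
  next
    case 3
    show thesis
    proof (rule that[of "(1 - \<bar>r\<bar>) / 2"])
      fix n
      have "\<bar>r ^ n\<bar> \<le> \<bar>r\<bar>" if "n > 0"
        using power_decreasing[of 1 n "\<bar>r\<bar>"] that 3 by (simp add: power_abs)
      then show "(1 - \<bar>r\<bar>) / 2 \<le> measure_pmf.prob (iid_degrees D n) (even_sum n)"
        unfolding prob_even_sum r_def[symmetric] by (cases "n = 0") (auto simp: abs_le_iff)
    qed (use 3 in simp)
  qed
qed

text \<open>As k^2 is the sum of 2 j + 1 over j < k, the second moment is the sum of (2 j + 1) P(D >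
  j). These terms are O(j^(2 - \<gamma>)), which is summable for \<gamma> > 3.\<close>

lemma integrable_square_of_tail:
  fixes \<gamma> :: real
  assumes "\<gamma> > 3" "(\<lambda>k. measure_pmf.prob D {k..}) \<in> O(\<lambda>k. real k powr (1 - \<gamma>))"
  shows "integrable (measure_pmf D) (\<lambda>k. (real k)\<^sup>2)"
proof -
  obtain C where C: "eventually (\<lambda>k. norm (measure_pmf.prob D {k..}) \<le> C * norm (real k powr (1 - \<gamma>))) at_top"
    using landau_o.bigE[OF assms(2)] by metis
  have "summable (\<lambda>j. real (2 * j + 1) * measure_pmf.prob D {j<..})"
  proof (rule summable_comparison_test_ev)
    show "eventually (\<lambda>j. norm (real (2 * j + 1) * measure_pmf.prob D {j<..}) \<le> 3 * C * real j powr (2 - \<gamma>)) sequentially"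
      using C eventually_gt_at_top[of 0]
    proof eventually_elim
      case (elim j)
      have "measure_pmf.prob D {j<..} \<le> measure_pmf.prob D {j..}"
        by (intro measure_pmf.finite_measure_mono) auto
      then have "measure_pmf.prob D {j<..} \<le> C * real j powr (1 - \<gamma>)" using elim by simp
      then have "real (2 * j + 1) * measure_pmf.prob D {j<..} \<le> (3 * real j) * (C * real j powr (1 - \<gamma>))"
        using elim by (intro mult_mono) auto
      also have "\<dots> = 3 * C * (real j * real j powr (1 - \<gamma>))" by simp
      also have "real j * real j powr (1 - \<gamma>) = real j powr (2 - \<gamma>)"
        using elim powr_add[of "real j" 1 "1 - \<gamma>"] by simp
      finally show ?case by simp
    qed
    show "summable (\<lambda>j. 3 * C * real j powr (2 - \<gamma>))"
      using assms(1) by (intro summable_mult) (simp add: summable_real_powr_iff)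
  qed
  then have fin: "(\<Sum>j. ennreal (real (2 * j + 1) * measure_pmf.prob D {j<..})) < \<infinity>"
    by (subst suminf_ennreal2) auto
  have sq: "ennreal ((real k)\<^sup>2) = (\<Sum>j. ennreal (real (2 * j + 1)) * indicator {j<..} k)" for k
  proof -
    have "(\<Sum>j. ennreal (real (2 * j + 1)) * indicator {j<..} k) = (\<Sum>j<k. ennreal (real (2 * j + 1)) * indicator {j<..} k)"
      by (rule suminf_finite) auto
    also have "\<dots> = (\<Sum>j<k. ennreal (real (2 * j + 1)))" by (rule sum.cong) auto
    also have "\<dots> = ennreal (\<Sum>j<k. real (2 * j + 1))" by (rule sum_ennreal) auto
    also have "(\<Sum>j<k. real (2 * j + 1)) = (real k)\<^sup>2"
      by (induction k) (auto simp: power2_eq_square algebra_simps)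
    finally show ?thesis by simp
  qed
  have "(\<integral>\<^sup>+k. ennreal ((real k)\<^sup>2) \<partial>measure_pmf D)
      = (\<Sum>j. \<integral>\<^sup>+k. ennreal (real (2 * j + 1)) * indicator {j<..} k \<partial>measure_pmf D)"
    unfolding sq by (rule nn_integral_suminf) auto
  also have "\<dots> = (\<Sum>j. ennreal (real (2 * j + 1) * measure_pmf.prob D {j<..}))"
    by (intro suminf_cong) (simp add: nn_integral_cmult_indicator measure_pmf.emeasure_eq_measure ennreal_mult)
  finally show ?thesis using fin by (intro integrableI_nonneg) auto
qed

section \<open>Largest component for given degrees\<close>

lemma card_largest_component_multigraph_of_matching:
  assumes "n \<ge> 1"
  shows "card (largest_component (multigraph_of_matching n M)) = Max ((\<lambda>v. card (component_of n M v)) ` {1..n})"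
proof -
  have "verts (multigraph_of_matching n M) = {1..n}" by (simp add: multigraph_of_matching_def)
  then show ?thesis
    using card_largest_component(2)[of "multigraph_of_matching n M"] assms
    by (simp add: graph_components_multigraph_of_matching image_image)
qed

lemma prob_configuration_model:
  assumes "even (\<Sum>i=1..n. d i)"
  shows "measure_pmf.prob (configuration_model n d) {G. Q G}
    = card {M \<in> perfect_matchings (half_edges n d). Q (multigraph_of_matching n M)}
      / matching_number (card (half_edges n d))"
proof -
  have ne: "perfect_matchings (half_edges n d) \<noteq> {}"
    using perfect_matchings_nonempty[OF finite_half_edges] assms by (simp add: card_half_edges)
  show ?thesis
    unfolding configuration_model_def
    by (simp add: measure_pmf_of_set[OF ne finite_perfect_matchings[OF finite_half_edges]]
        card_perfect_matchings[OF finite_half_edges] vimage_def Int_def)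
qed

lemma prob_configuration_model_le:
  fixes q :: real
  assumes "even (\<Sum>i=1..n. d i)"
    and "card {M \<in> perfect_matchings (half_edges n d). Q (multigraph_of_matching n M)}
      \<le> q * matching_number (card (half_edges n d))"
  shows "measure_pmf.prob (configuration_model n d) {G. Q G} \<le> q"
proof -
  have "perfect_matchings (half_edges n d) \<noteq> {}"
    using perfect_matchings_nonempty[OF finite_half_edges] assms(1) by (simp add: card_half_edges)
  then have "matching_number (card (half_edges n d)) > 0"
    using card_perfect_matchings[OF finite_half_edges, of n d]
      finite_perfect_matchings[OF finite_half_edges, of n d] by (metis card_gt_0_iff)
  then show ?thesis
    unfolding prob_configuration_model[OF assms(1)] using assms(2) by (simp add: divide_le_eq)
qed

lemma set_pmf_configuration_model:
  assumes "even (\<Sum>i=1..n. d i)"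
  shows "set_pmf (configuration_model n d) = multigraph_of_matching n ` perfect_matchings (half_edges n d)"
  using perfect_matchings_nonempty[OF finite_half_edges] assms
  by (simp add: configuration_model_def card_half_edges finite_perfect_matchings[OF finite_half_edges])

text \<open>S is meant for the vertices of small degree; J bounds the number of the others and y all
  degrees. The first term is the union bound over starting vertices, the second the chance that an
  exploration from outside S meets a further vertex outside S.\<close>

lemma prob_largest_component_gt_le:
  fixes \<theta> \<kappa> c x y J :: real
  assumes "n \<ge> 1" "even (\<Sum>i=1..n. d i)" and \<theta>: "0 < \<theta>" and \<kappa>: "0 < \<kappa>" "\<kappa> \<le> 1"
    and c: "0 < c" and S: "S \<subseteq> {1..n}"
    and d: "\<And>i. i \<in> {1..n} \<Longrightarrow> real (d i) \<le> y"
    and drift: "(\<Sum>i\<in>S. d i * (exp (\<theta> * (real (d i) - 2 + \<kappa>)) - 1)) \<le> - c * \<theta> * n"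
    and J: "card ({1..n} - S) \<le> J"
    and x: "0 \<le> x" "(y + x) / \<kappa> + 2 \<le> c * n / 2"
  shows "measure_pmf.prob (configuration_model n d)
      {G. (real (Max (d ` {1..n})) + x) / \<kappa> + 1 < card (largest_component G)}
    \<le> 2 * real n * exp (- \<theta> * x) + 2 * (y * J)\<^sup>2 / (c * n)"
proof (rule prob_configuration_model_le[OF assms(2)])
  define \<Delta> where "\<Delta> = real (Max (d ` {1..n}))"
  \<comment> \<open>Rounding up gives \<kappa> * m \<ge> \<Delta> + x, so that the exponent is at
    most - \<theta> * x; it costs the + 1 in the threshold.\<close>
  define m where "m = nat \<lceil>(\<Delta> + x) / \<kappa>\<rceil>"
  define B where "B = (\<Sum>w\<in>{1..n} - S. real (d w))"
  \<comment> \<open>At most half of the linear drift c * n is consumed by m + 1; \<beta> makes the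
    other half balance B exactly.\<close>
  define \<beta> where "\<beta> = 2 * B / (c * n)"
  let ?P = "perfect_matchings (half_edges n d)" and ?N = "real (matching_number (card (half_edges n d)))"
  have d\<Delta>: "real (d i) \<le> \<Delta>" if "i \<in> {1..n}" for i
    unfolding \<Delta>_def using that by simp
  have "Max (d ` {1..n}) \<in> d ` {1..n}" using assms(1) by (intro Max_in) auto
  then have \<Delta>y: "\<Delta> \<le> y" using d unfolding \<Delta>_def by auto
  have \<Delta>0: "0 \<le> \<Delta>" by (simp add: \<Delta>_def)
  have cn: "0 < c * n" using c assms(1) by simp
  have m: "(\<Delta> + x) / \<kappa> \<le> m" "m \<le> (\<Delta> + x) / \<kappa> + 1"
    unfolding m_def using \<Delta>0 x \<kappa> by (simp_all add: nat_ceiling_le_eq)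
  have "(\<Delta> + x) / \<kappa> \<le> (y + x) / \<kappa>" using \<Delta>y \<kappa> by (intro divide_right_mono) auto
  then have m1: "real m + 1 \<le> c * n / 2" using m(2) x(2) by linarith
  have "\<Delta> + x \<le> \<kappa> * m" using m(1) \<kappa> by (simp add: divide_le_eq mult.commute)
  then have e: "exp (\<theta> * (\<Delta> - \<kappa> * m)) \<le> exp (- \<theta> * x)"
    using mult_left_mono[of "\<Delta> - \<kappa> * m" "- x" \<theta>] \<theta> by simp
  have B0: "0 \<le> B" unfolding B_def by (intro sum_nonneg) simp
  have B: "B \<le> y * J"
  proof -
    have "B \<le> card ({1..n} - S) * y" unfolding B_def using d by (intro sum_bounded_above) auto
    also have "\<dots> \<le> J * y" using J \<Delta>y \<Delta>0 by (intro mult_right_mono) auto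
    finally show ?thesis by (simp add: mult.commute)
  qed
  \<comment> \<open>By exp t \<ge> 1 + t and \<kappa> \<ge> 0, the exponential drift is at least
    \<theta> times the linear one, so the single hypothesis \<open>drift\<close> controls both
    supermartingales.\<close>
  have "\<theta> * (\<Sum>w\<in>S. d w * (real (d w) - 2)) \<le> (\<Sum>i\<in>S. d i * (exp (\<theta> * (real (d i) - 2 + \<kappa>)) - 1))"
    unfolding sum_distrib_left
  proof (rule sum_mono)
    fix w
    have "1 + \<theta> * (real (d w) - 2 + \<kappa>) \<le> exp (\<theta> * (real (d w) - 2 + \<kappa>))" by (rule exp_ge_add_one_self)
    moreover have "0 \<le> \<theta> * \<kappa>" using \<theta> \<kappa> by simp
    ultimately have "\<theta> * (real (d w) - 2) \<le> exp (\<theta> * (real (d w) - 2 + \<kappa>)) - 1"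
      by (simp add: algebra_simps)
    then have "real (d w) * (\<theta> * (real (d w) - 2)) \<le> d w * (exp (\<theta> * (real (d w) - 2 + \<kappa>)) - 1)"
      by (rule mult_left_mono) simp
    then show "\<theta> * (d w * (real (d w) - 2)) \<le> d w * (exp (\<theta> * (real (d w) - 2 + \<kappa>)) - 1)"
      by (simp add: mult.left_commute)
  qed
  then have "\<theta> * (\<Sum>w\<in>S. d w * (real (d w) - 2)) \<le> \<theta> * (- c * n)"
    using drift by (simp add: mult.left_commute mult.commute)
  then have lin: "(\<Sum>w\<in>S. d w * (real (d w) - 2)) \<le> - (c * n)"
    using \<theta> by (simp only: mult_le_cancel_left_pos mult_minus_left)
  have "card {M \<in> ?P. \<exists>v\<in>{1..n}. m < card (component_of n M v)}
      \<le> (2 * real n * exp (\<theta> * (\<Delta> - \<kappa> * m)) + \<beta> * (\<Sum>w\<in>{1..n} - S. real (d w))) * ?N"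
  proof (rule card_large_component_le)
    have "real (m + 1) * \<theta> \<le> (c * n) * \<theta>" using m1 cn \<theta> by (intro mult_right_mono) auto
    then show "(\<Sum>w\<in>S. d w * (exp (\<theta> * (real (d w) - 2 + \<kappa>)) - 1)) + (m + 1) * \<theta> \<le> 0"
      using drift by (simp add: algebra_simps)
    have "\<beta> * ((\<Sum>w\<in>S. d w * (real (d w) - 2)) + (m + 1)) \<le> \<beta> * (- (c * n / 2))"
      using lin m1 B0 cn by (intro mult_left_mono) (auto simp: \<beta>_def)
    also have "\<dots> = - B" using c assms(1) by (auto simp: \<beta>_def field_simps)
    finally show "(\<Sum>w\<in>{1..n} - S. real (d w)) + \<beta> * ((\<Sum>w\<in>S. d w * (real (d w) - 2)) + (m + 1)) \<le> 0"
      by (simp add: B_def)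
    show "0 \<le> \<beta>" using B0 cn by (simp add: \<beta>_def)
  qed (use \<theta> \<kappa> S d\<Delta> in auto)
  also have "\<dots> \<le> (2 * real n * exp (- \<theta> * x) + 2 * (y * J)\<^sup>2 / (c * n)) * ?N"
  proof (intro mult_right_mono add_mono mult_left_mono e)
    have "B * B \<le> (y * J)\<^sup>2" unfolding power2_eq_square using B B0 by (intro mult_mono) auto
    then show "\<beta> * (\<Sum>w\<in>{1..n} - S. real (d w)) \<le> 2 * (y * J)\<^sup>2 / (c * n)"
      unfolding B_def[symmetric] \<beta>_def using cn by (simp add: divide_right_mono mult.assoc)
  qed auto
  moreover have "{M \<in> ?P. (real (Max (d ` {1..n})) + x) / \<kappa> + 1 < card (largest_component (multigraph_of_matching n M))}
      \<subseteq> {M \<in> ?P. \<exists>v\<in>{1..n}. m < card (component_of n M v)}"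
  proof (clarify)
    fix M assume "(real (Max (d ` {1..n})) + x) / \<kappa> + 1 < card (largest_component (multigraph_of_matching n M))"
    then have "m < Max ((\<lambda>v. card (component_of n M v)) ` {1..n})"
      using m(2) unfolding card_largest_component_multigraph_of_matching[OF assms(1)] \<Delta>_def by linarith
    then show "\<exists>v\<in>{1..n}. m < card (component_of n M v)"
      using assms(1) by (subst (asm) Max_gr_iff) auto
  qed
  then have "card {M \<in> ?P. (real (Max (d ` {1..n})) + x) / \<kappa> + 1 < card (largest_component (multigraph_of_matching n M))}
      \<le> card {M \<in> ?P. \<exists>v\<in>{1..n}. m < card (component_of n M v)}"
    by (rule card_mono[rotated]) (simp add: finite_perfect_matchings[OF finite_half_edges])
  ultimately show "card {M \<in> ?P. (real (Max (d ` {1..n})) + x) / \<kappa> + 1 < card (largest_component (multigraph_of_matching n M))}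
      \<le> (2 * real n * exp (- \<theta> * x) + 2 * (y * J)\<^sup>2 / (c * n)) * ?N"
    by linarith
qed

text \<open>The exploration starts at a vertex of maximum degree. The number m of vertices asked for
  is at most y / \<kappa>, and 8 bounds exp (2 * \<theta>) - 1 for \<theta> \<le> 1; this explains
  the left side of \<open>drift\<close>.\<close>

lemma prob_largest_component_less_le:
  fixes \<theta> \<kappa> x y :: real
  assumes "n \<ge> 1" "even (\<Sum>i=1..n. d i)" and \<theta>: "0 < \<theta>" "\<theta> \<le> 1" and \<kappa>: "0 < \<kappa>"
    and d: "\<And>i. i \<in> {1..n} \<Longrightarrow> real (d i) \<le> y" and x: "0 \<le> x"
    and drift: "8 * (y + y / \<kappa> * y) + (y / \<kappa> + 1) * y
      \<le> (\<Sum>i\<in>{1..n}. d i * (1 - exp (- \<theta> * (real (d i) - 2 + \<kappa>))))"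
  shows "measure_pmf.prob (configuration_model n d)
      {G. card (largest_component G) < (real (Max (d ` {1..n})) - x) / \<kappa>} \<le> exp (- \<theta> * x)"
proof (rule prob_configuration_model_le[OF assms(2)])
  define \<Delta> where "\<Delta> = real (Max (d ` {1..n}))"
  let ?P = "perfect_matchings (half_edges n d)" and ?N = "real (matching_number (card (half_edges n d)))"
  have d\<Delta>: "real (d i) \<le> \<Delta>" if "i \<in> {1..n}" for i
    unfolding \<Delta>_def using that by simp
  have "Max (d ` {1..n}) \<in> d ` {1..n}" using assms(1) by (intro Max_in) auto
  then obtain v where v: "v \<in> {1..n}" "real (d v) = \<Delta>" unfolding \<Delta>_def by auto
  have \<Delta>y: "\<Delta> \<le> y" "0 \<le> \<Delta>" using d[OF v(1)] v(2) by auto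
  show "card {M \<in> ?P. card (largest_component (multigraph_of_matching n M)) < (real (Max (d ` {1..n})) - x) / \<kappa>}
      \<le> exp (- \<theta> * x) * ?N"
  \<comment> \<open>If \<Delta> \<le> x the threshold is not positive and the event is empty;
    otherwise converting the floor to a natural number is harmless.\<close>
  proof (cases "\<Delta> \<le> x")
    case True
    then have "(\<Delta> - x) / \<kappa> \<le> 0" using \<kappa> by (simp add: divide_le_0_iff)
    then have "{M \<in> ?P. card (largest_component (multigraph_of_matching n M)) < (\<Delta> - x) / \<kappa>} = {}"
      by (auto simp: not_less intro: order_trans)
    then show ?thesis unfolding \<Delta>_def by (simp only: card.empty) simp
  next
    case False
    define m where "m = nat \<lfloor>(\<Delta> - x) / \<kappa>\<rfloor>"
    have m: "m \<le> (\<Delta> - x) / \<kappa>" unfolding m_def using False \<kappa> by simp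
    also have "\<dots> \<le> y / \<kappa>" using \<Delta>y x \<kappa> by (intro divide_right_mono) auto
    finally have my: "m \<le> y / \<kappa>" .
    have "\<kappa> * m \<le> \<Delta> - x" using m \<kappa> by (simp add: le_divide_eq mult.commute)
    then have "\<theta> * (\<kappa> * m - d v) \<le> \<theta> * (- x)" using v \<theta> by (intro mult_left_mono) auto
    then have e: "exp (\<theta> * (\<kappa> * m - d v)) \<le> exp (- \<theta> * x)" by simp
    have "exp (2 * \<theta>) \<le> exp (1 + 1 :: real)" using \<theta> by simp
    also have "\<dots> = exp 1 * exp 1" by (rule exp_add)
    also have "\<dots> \<le> 3 * 3" using exp_le by (intro mult_mono) auto
    finally have e2: "exp (2 * \<theta>) - 1 \<le> 8" by simp
    have "card {M \<in> ?P. card (component_of n M v) \<le> m} \<le> exp (\<theta> * (\<kappa> * m - d v)) * ?N"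
    proof (rule card_small_component_le[where \<Delta> = \<Delta>])
      have my2: "m * \<Delta> \<le> y / \<kappa> * y" using my \<Delta>y \<kappa> by (intro mult_mono) auto
      then have "d v + m * \<Delta> \<le> y + y / \<kappa> * y" using v(2) \<Delta>y by linarith
      moreover have "0 \<le> y + y / \<kappa> * y" using \<Delta>y \<kappa> by simp
      ultimately have "(d v + m * \<Delta>) * (exp (2 * \<theta>) - 1) \<le> (y + y / \<kappa> * y) * 8"
        using e2 \<theta> by (intro mult_mono) auto
      moreover have "(m + 1) * \<Delta> \<le> (y / \<kappa> + 1) * y" using my \<Delta>y by (intro mult_mono) auto
      ultimately show "(d v + m * \<Delta>) * (exp (2 * \<theta>) - 1) + (m + 1) * \<Delta>
          \<le> (\<Sum>w\<in>{1..n}. d w * (1 - exp (- \<theta> * (real (d w) - 2 + \<kappa>))))"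
        using drift by linarith
    qed (use \<theta> \<kappa> v d\<Delta> in auto)
    also have "\<dots> \<le> exp (- \<theta> * x) * ?N" using e by (rule mult_right_mono) simp
    moreover have "{M \<in> ?P. card (largest_component (multigraph_of_matching n M)) < (\<Delta> - x) / \<kappa>}
        \<subseteq> {M \<in> ?P. card (component_of n M v) \<le> m}"
    proof clarify
      fix M assume "card (largest_component (multigraph_of_matching n M)) < (\<Delta> - x) / \<kappa>"
      moreover have "card (component_of n M v) \<le> card (largest_component (multigraph_of_matching n M))"
        unfolding card_largest_component_multigraph_of_matching[OF assms(1)] using v(1) by simp
      ultimately have "real (card (component_of n M v)) < (\<Delta> - x) / \<kappa>" by linarith
      then show "card (component_of n M v) \<le> m" unfolding m_def by (simp add: le_nat_floor)
    qed
    then have "card {M \<in> ?P. card (largest_component (multigraph_of_matching n M)) < (\<Delta> - x) / \<kappa>}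
        \<le> card {M \<in> ?P. card (component_of n M v) \<le> m}"
      by (rule card_mono[rotated]) (simp add: finite_perfect_matchings[OF finite_half_edges])
    ultimately show ?thesis unfolding \<Delta>_def by linarith
  qed
qed

section \<open>Concentration of the drift\<close>

lemma abs_exp_minus_one_le:
  fixes x :: real
  assumes "x \<le> 1"
  shows "\<bar>exp x - 1\<bar> \<le> 2 * \<bar>x\<bar>" "\<bar>exp x - 1\<bar> \<le> 2"
proof -
  show "\<bar>exp x - 1\<bar> \<le> 2 * \<bar>x\<bar>"
  proof (cases "0 \<le> x")
    case True
    then have "x\<^sup>2 \<le> x" using assms by (simp add: power2_eq_square mult_left_le)
    then show ?thesis using exp_bound[of x] True assms by simp
  next
    case False
    then have "\<bar>exp x - 1\<bar> = 1 - exp x" by simp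
    then show ?thesis using exp_ge_add_one_self[of x] False by linarith
  qed
  have "exp x \<le> exp 1" using assms by simp
  then have "exp x \<le> 3" using exp_le by linarith
  then show "\<bar>exp x - 1\<bar> \<le> 2" by (simp add: abs_le_iff) (use exp_gt_zero[of x] in linarith)
qed

text \<open>These are the bounds \<open>gC\<close> and \<open>gs\<close> of
  \<open>prob_iid_degrees_average_tendsto\<close>: the quadratic one is free of t and serves as
  majorant, the linear one controls the variance. Either sign of t occurs, one for each
  supermartingale.\<close>

lemma abs_drift_le:
  fixes t \<kappa> :: real and k :: nat
  assumes "0 \<le> \<kappa>" "\<kappa> \<le> 2" "t \<noteq> 0" "t * (real k - 2 + \<kappa>) \<le> 1"
  shows "\<bar>k * (exp (t * (real k - 2 + \<kappa>)) - 1) / t\<bar> \<le> 6 * (real k)\<^sup>2"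
    and "\<bar>k * (exp (t * (real k - 2 + \<kappa>)) - 1) / t\<bar> \<le> 6 / \<bar>t\<bar> * k"
proof -
  let ?x = "t * (real k - 2 + \<kappa>)"
  have eq: "\<bar>k * (exp ?x - 1) / t\<bar> = k * (\<bar>exp ?x - 1\<bar> / \<bar>t\<bar>)" by (simp add: abs_mult)
  show "\<bar>k * (exp ?x - 1) / t\<bar> \<le> 6 * (real k)\<^sup>2"
  proof (cases "k = 0")
    case False
    have "\<bar>exp ?x - 1\<bar> \<le> 2 * (\<bar>t\<bar> * \<bar>real k - 2 + \<kappa>\<bar>)"
      using abs_exp_minus_one_le(1)[OF assms(4)] by (simp add: abs_mult)
    also have "\<bar>real k - 2 + \<kappa>\<bar> \<le> 3 * k" using False assms(1,2) by (simp add: abs_le_iff)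
    finally have "\<bar>exp ?x - 1\<bar> / \<bar>t\<bar> \<le> 6 * k" using assms(3) by (simp add: divide_le_eq mult_ac)
    then have "k * (\<bar>exp ?x - 1\<bar> / \<bar>t\<bar>) \<le> k * (6 * real k)" by (intro mult_left_mono) auto
    then show ?thesis unfolding eq by (simp add: power2_eq_square)
  qed simp
  have "\<bar>exp ?x - 1\<bar> / \<bar>t\<bar> \<le> 6 / \<bar>t\<bar>"
    using abs_exp_minus_one_le(2)[OF assms(4)] by (intro divide_right_mono) auto
  then have "k * (\<bar>exp ?x - 1\<bar> / \<bar>t\<bar>) \<le> k * (6 / \<bar>t\<bar>)" by (intro mult_left_mono) auto
  then show "\<bar>k * (exp ?x - 1) / t\<bar> \<le> 6 / \<bar>t\<bar> * k" unfolding eq by (simp add: mult.commute)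
qed

lemma exp_difference_quotient_tendsto:
  fixes c :: real and t :: "nat \<Rightarrow> real"
  assumes "t \<longlonglongrightarrow> 0" "\<And>n. t n \<noteq> 0"
  shows "(\<lambda>n. (exp (t n * c) - 1) / t n) \<longlonglongrightarrow> c"
proof -
  have "((\<lambda>h. exp (h * c)) has_real_derivative c) (at 0)"
    by (auto intro!: derivative_eq_intros)
  then have "((\<lambda>h. (exp (h * c) - 1) / h) \<longlongrightarrow> c) (at 0)"
    by (simp add: DERIV_def)
  moreover have "filterlim t (at 0) sequentially"
    using assms by (simp add: filterlim_at)
  ultimately show ?thesis by (rule filterlim_compose)
qed

text \<open>Uses k (k - 2 + \<kappa>) = k (k - 1) + (\<kappa> - 1) k. The drift changes sign at
  \<kappa> = 1 - \<nu>, which is the origin of the factor 1 / (1 - \<nu>).\<close>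

lemma expectation_drift:
  assumes "integrable (measure_pmf D) (\<lambda>k. (real k)\<^sup>2)" "measure_pmf.expectation D real > 0"
  shows "measure_pmf.expectation D (\<lambda>k. real k * (real k - 2 + \<kappa>))
    = measure_pmf.expectation D real * (nu D - 1 + \<kappa>)"
proof -
  have int: "integrable (measure_pmf D) real"
    using measure_pmf.square_integrable_imp_integrable[of real] assms(1) by simp
  then have int2: "integrable (measure_pmf D) (\<lambda>k. real k * (real k - 1))"
    using assms(1) by (simp add: power2_eq_square right_diff_distrib)
  have "(\<lambda>k. real k * (real k - 2 + \<kappa>)) = (\<lambda>k. real k * (real k - 1) + (\<kappa> - 1) * real k)"
    by (simp add: algebra_simps)
  then have "measure_pmf.expectation D (\<lambda>k. real k * (real k - 2 + \<kappa>))
      = measure_pmf.expectation D (\<lambda>k. real k * (real k - 1)) + (\<kappa> - 1) * measure_pmf.expectation D real"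
    using int int2 by simp
  also have "measure_pmf.expectation D (\<lambda>k. real k * (real k - 1)) = nu D * measure_pmf.expectation D real"
    using assms(2) by (simp add: nu_def)
  finally show ?thesis by (simp add: algebra_simps)
qed

text \<open>Divided by \<open>\<theta> n\<close>, the summands tend to k (k - 2 + \<kappa>), of mean
  - 2 * c, so exceeding - c * n is a deviation of order n. The truncation keeps the exponent at most
  1, as \<open>abs_drift_le\<close> requires, and disappears in the limit because \<theta> tends to
  0.\<close>

lemma prob_truncated_drift_tendsto:
  fixes \<kappa> c :: real and \<theta> :: "nat \<Rightarrow> real"
  assumes D2: "integrable (measure_pmf D) (\<lambda>k. (real k)\<^sup>2)" and ED: "measure_pmf.expectation D real > 0"
    and \<kappa>: "0 \<le> \<kappa>" "\<kappa> < 1 - nu D" "\<kappa> \<le> 2"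
    and \<theta>: "\<And>n. 0 < \<theta> n" "\<And>n. \<theta> n \<le> 1 / 2" "\<theta> \<longlonglongrightarrow> 0" "(\<lambda>n. (1 / \<theta> n)\<^sup>2 / n) \<longlonglongrightarrow> 0"
  defines "c \<equiv> measure_pmf.expectation D real * (1 - nu D - \<kappa>) / 2"
  shows "(\<lambda>n. measure_pmf.prob (iid_degrees D n) {d. \<not> (\<Sum>i | i \<in> {1..n} \<and> \<theta> n * d i \<le> 1.
      d i * (exp (\<theta> n * (real (d i) - 2 + \<kappa>)) - 1)) \<le> - c * \<theta> n * n}) \<longlonglongrightarrow> 0"
proof -
  define g where "g n k = (if \<theta> n * real k \<le> 1 then k * (exp (\<theta> n * (real k - 2 + \<kappa>)) - 1) / \<theta> n else 0)" for n k
  have c: "c > 0" using ED \<kappa> by (simp add: c_def)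
  have EG: "measure_pmf.expectation D (\<lambda>k. real k * (real k - 2 + \<kappa>)) = - 2 * c"
    unfolding expectation_drift[OF D2 ED] c_def by (simp add: algebra_simps)
  have x: "\<theta> n * (real k - 2 + \<kappa>) \<le> 1" if "\<theta> n * real k \<le> 1" for n k
  proof -
    have "\<theta> n * (real k - 2 + \<kappa>) \<le> \<theta> n * real k" using \<theta>(1)[of n] \<kappa> by simp
    then show ?thesis using that by linarith
  qed
  have lim: "(\<lambda>n. measure_pmf.prob (iid_degrees D n)
      {d. c * n \<le> \<bar>(\<Sum>i=1..n. g n (d i)) - n * measure_pmf.expectation D (\<lambda>k. real k * (real k - 2 + \<kappa>))\<bar>}) \<longlonglongrightarrow> 0"
  proof (rule prob_iid_degrees_average_tendsto[OF D2, where C = 6 and s = "\<lambda>n. 6 / \<bar>\<theta> n\<bar>"])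
    show "\<bar>g n k\<bar> \<le> 6 * (real k)\<^sup>2" "\<bar>g n k\<bar> \<le> 6 / \<bar>\<theta> n\<bar> * real k" for n k
      using abs_drift_le[OF \<kappa>(1,3), of "\<theta> n" k] x[of n k] \<theta>(1)[of n] by (auto simp: g_def)
    show "(\<lambda>n. (6 / \<bar>\<theta> n\<bar>)\<^sup>2 / n) \<longlonglongrightarrow> 0"
      using tendsto_mult_right_zero[OF \<theta>(4), of 36] by (simp add: power_divide)
    show "(\<lambda>n. g n k) \<longlonglongrightarrow> real k * (real k - 2 + \<kappa>)" for k
    proof -
      have "(\<lambda>n. k * ((exp (\<theta> n * (real k - 2 + \<kappa>)) - 1) / \<theta> n)) \<longlonglongrightarrow> k * (real k - 2 + \<kappa>)"
        using \<theta>(1) by (intro tendsto_mult tendsto_const exp_difference_quotient_tendsto[OF \<theta>(3)]) (simp add: less_imp_neq[symmetric])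
      moreover have "eventually (\<lambda>n. \<theta> n * real k < 1) sequentially"
        using tendsto_mult_left_zero[OF \<theta>(3), of "real k"] by (rule order_tendstoD) simp
      then have "eventually (\<lambda>n. k * ((exp (\<theta> n * (real k - 2 + \<kappa>)) - 1) / \<theta> n) = g n k) sequentially"
        by eventually_elim (simp add: g_def)
      ultimately show ?thesis by (rule Lim_transform_eventually)
    qed
  qed (rule c)
  have le: "measure_pmf.prob (iid_degrees D n) {d. \<not> (\<Sum>i | i \<in> {1..n} \<and> \<theta> n * d i \<le> 1.
      d i * (exp (\<theta> n * (real (d i) - 2 + \<kappa>)) - 1)) \<le> - c * \<theta> n * n}
      \<le> measure_pmf.prob (iid_degrees D n)
      {d. c * n \<le> \<bar>(\<Sum>i=1..n. g n (d i)) - n * measure_pmf.expectation D (\<lambda>k. real k * (real k - 2 + \<kappa>))\<bar>}" for n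
  proof (intro measure_pmf.finite_measure_mono subsetI CollectI)
    fix d assume "d \<in> {d. \<not> (\<Sum>i | i \<in> {1..n} \<and> \<theta> n * d i \<le> 1.
      d i * (exp (\<theta> n * (real (d i) - 2 + \<kappa>)) - 1)) \<le> - c * \<theta> n * n}"
    then have "- c * n * \<theta> n < (\<Sum>i | i \<in> {1..n} \<and> \<theta> n * d i \<le> 1.
      d i * (exp (\<theta> n * (real (d i) - 2 + \<kappa>)) - 1))" by (simp add: mult_ac)
    also have "\<dots> = (\<Sum>i=1..n. g n (d i)) * \<theta> n"
      unfolding sum_distrib_right using \<theta>(1)[of n]
      by (intro sum.mono_neutral_cong_left) (auto simp: g_def)
    finally have "- c * n < (\<Sum>i=1..n. g n (d i))" by (simp only: mult_less_cancel_right_pos[OF \<theta>(1)])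
    then have "c * n \<le> (\<Sum>i=1..n. g n (d i)) - n * (- 2 * c)" by (simp add: algebra_simps)
    then show "c * n \<le> \<bar>(\<Sum>i=1..n. g n (d i)) - n * measure_pmf.expectation D (\<lambda>k. real k * (real k - 2 + \<kappa>))\<bar>"
      unfolding EG by linarith
  qed simp
  show ?thesis
    by (rule tendsto_sandwich[OF _ _ tendsto_const lim]) (use le in \<open>auto intro!: always_eventually\<close>)
qed

text \<open>The same argument with t = - \<theta> and mean 2 * c. The exponent is now at most 2 *
  \<theta> \<le> 1 for every degree, so the sum runs over all vertices.\<close>

lemma prob_reverse_drift_tendsto:
  fixes \<kappa> c :: real and \<theta> :: "nat \<Rightarrow> real"
  assumes D2: "integrable (measure_pmf D) (\<lambda>k. (real k)\<^sup>2)" and ED: "measure_pmf.expectation D real > 0"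
    and \<kappa>: "0 \<le> \<kappa>" "1 - nu D < \<kappa>" "\<kappa> \<le> 2"
    and \<theta>: "\<And>n. 0 < \<theta> n" "\<And>n. \<theta> n \<le> 1 / 2" "\<theta> \<longlonglongrightarrow> 0" "(\<lambda>n. (1 / \<theta> n)\<^sup>2 / n) \<longlonglongrightarrow> 0"
  defines "c \<equiv> measure_pmf.expectation D real * (\<kappa> - (1 - nu D)) / 2"
  shows "(\<lambda>n. measure_pmf.prob (iid_degrees D n) {d. \<not> c * \<theta> n * n \<le> (\<Sum>i=1..n.
      d i * (1 - exp (- \<theta> n * (real (d i) - 2 + \<kappa>))))}) \<longlonglongrightarrow> 0"
proof -
  define g where "g n k = k * (exp (- \<theta> n * (real k - 2 + \<kappa>)) - 1) / (- \<theta> n)" for n k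
  have c: "c > 0" using ED \<kappa> by (simp add: c_def)
  have EG: "measure_pmf.expectation D (\<lambda>k. real k * (real k - 2 + \<kappa>)) = 2 * c"
    unfolding expectation_drift[OF D2 ED] c_def by (simp add: algebra_simps)
  have x: "- \<theta> n * (real k - 2 + \<kappa>) \<le> 1" for n k
  proof -
    have "- \<theta> n * (real k - 2 + \<kappa>) \<le> - \<theta> n * (- 2)" using \<theta>(1)[of n] \<kappa> by (intro mult_left_mono_neg) auto
    then show ?thesis using \<theta>(2)[of n] by linarith
  qed
  have lim: "(\<lambda>n. measure_pmf.prob (iid_degrees D n)
      {d. c * n \<le> \<bar>(\<Sum>i=1..n. g n (d i)) - n * measure_pmf.expectation D (\<lambda>k. real k * (real k - 2 + \<kappa>))\<bar>}) \<longlonglongrightarrow> 0"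
  proof (rule prob_iid_degrees_average_tendsto[OF D2, where C = 6 and s = "\<lambda>n. 6 / \<bar>- \<theta> n\<bar>"])
    show "\<bar>g n k\<bar> \<le> 6 * (real k)\<^sup>2" "\<bar>g n k\<bar> \<le> 6 / \<bar>- \<theta> n\<bar> * real k" for n k
      unfolding g_def using \<theta>(1)[of n] by (intro abs_drift_le[OF \<kappa>(1,3) _ x]; simp)+
    show "(\<lambda>n. (6 / \<bar>- \<theta> n\<bar>)\<^sup>2 / n) \<longlonglongrightarrow> 0"
      using tendsto_mult_right_zero[OF \<theta>(4), of 36] by (simp add: power_divide)
    show "(\<lambda>n. g n k) \<longlonglongrightarrow> real k * (real k - 2 + \<kappa>)" for k
    proof -
      have "(\<lambda>n. k * ((exp (- \<theta> n * (real k - 2 + \<kappa>)) - 1) / - \<theta> n)) \<longlonglongrightarrow> k * (real k - 2 + \<kappa>)"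
        using \<theta>(1) tendsto_minus[OF \<theta>(3)]
        by (intro tendsto_mult tendsto_const exp_difference_quotient_tendsto) (simp_all add: less_imp_neq[symmetric])
      then show ?thesis by (simp add: g_def)
    qed
  qed (rule c)
  have le: "measure_pmf.prob (iid_degrees D n) {d. \<not> c * \<theta> n * n \<le> (\<Sum>i=1..n.
      d i * (1 - exp (- \<theta> n * (real (d i) - 2 + \<kappa>))))}
      \<le> measure_pmf.prob (iid_degrees D n)
      {d. c * n \<le> \<bar>(\<Sum>i=1..n. g n (d i)) - n * measure_pmf.expectation D (\<lambda>k. real k * (real k - 2 + \<kappa>))\<bar>}" for n
  proof (intro measure_pmf.finite_measure_mono subsetI CollectI)
    fix d assume d: "d \<in> {d. \<not> c * \<theta> n * n \<le> (\<Sum>i=1..n.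
      d i * (1 - exp (- \<theta> n * (real (d i) - 2 + \<kappa>))))}"
    have "k * (1 - e) = k * (e - 1) / (- t) * t" if "0 < t" for k e t :: real
      using that by (simp add: field_simps)
    then have "(\<Sum>i=1..n. d i * (1 - exp (- \<theta> n * (real (d i) - 2 + \<kappa>)))) = (\<Sum>i=1..n. g n (d i)) * \<theta> n"
      unfolding sum_distrib_right g_def using \<theta>(1)[of n] by (intro sum.cong refl) blast
    then have "(\<Sum>i=1..n. g n (d i)) * \<theta> n < (c * n) * \<theta> n" using d by (simp add: mult_ac)
    then have "(\<Sum>i=1..n. g n (d i)) < c * n" using \<theta>(1)[of n] by simp
    then have "c * n \<le> n * (2 * c) - (\<Sum>i=1..n. g n (d i))" by (simp add: algebra_simps)
    then show "c * n \<le> \<bar>(\<Sum>i=1..n. g n (d i)) - n * measure_pmf.expectation D (\<lambda>k. real k * (real k - 2 + \<kappa>))\<bar>"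
      unfolding EG by linarith
  qed simp
  show ?thesis
    by (rule tendsto_sandwich[OF _ _ tendsto_const lim]) (use le in \<open>auto intro!: always_eventually\<close>)
qed

section \<open>The largest component of the random multigraph\<close>

text \<open>Passes to real thresholds, as the later cut-offs need not be integers. Rounding up is
  harmless because the power is decreasing.\<close>

lemma tail_bound:
  fixes \<gamma> :: real
  assumes "\<gamma> > 3" "(\<lambda>k. measure_pmf.prob D {k..}) \<in> O(\<lambda>k. real k powr (1 - \<gamma>))"
  obtains C where "C > 0"
    "eventually (\<lambda>x::real. measure_pmf.prob D {k. x < real k} \<le> C * x powr (1 - \<gamma>)) at_top"
proof -
  obtain C where C: "C > 0" "eventually (\<lambda>k. norm (measure_pmf.prob D {k..}) \<le> C * norm (real k powr (1 - \<gamma>))) at_top"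
    using landau_o.bigE[OF assms(2)] by metis
  then obtain N where N: "\<And>k. k \<ge> N \<Longrightarrow> measure_pmf.prob D {k..} \<le> C * real k powr (1 - \<gamma>)"
    unfolding eventually_at_top_linorder by auto
  have bound: "measure_pmf.prob D {k. x < real k} \<le> C * x powr (1 - \<gamma>)" if x: "x \<ge> real N" "x > 0" for x :: real
  proof -
    have k: "x \<le> real (nat \<lceil>x\<rceil>)" by (simp add: real_nat_ceiling_ge)
    then have "N \<le> nat \<lceil>x\<rceil>" using x by linarith
    have "measure_pmf.prob D {k. x < real k} \<le> measure_pmf.prob D {nat \<lceil>x\<rceil>..}"
      by (intro measure_pmf.finite_measure_mono) (auto simp: nat_ceiling_le_eq)
    also have "\<dots> \<le> C * real (nat \<lceil>x\<rceil>) powr (1 - \<gamma>)" by (rule N) fact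
    also have "\<dots> \<le> C * x powr (1 - \<gamma>)"
      using C(1) x k assms(1) by (intro mult_left_mono powr_mono2') auto
    finally show ?thesis .
  qed
  from eventually_ge_at_top[of "real N"] eventually_gt_at_top[of "0 :: real"]
  have "eventually (\<lambda>x::real. measure_pmf.prob D {k. x < real k} \<le> C * x powr (1 - \<gamma>)) at_top"
    by eventually_elim (rule bound)
  with C(1) show thesis by (rule that)
qed

lemma prob_bind_pmf_le:
  assumes "\<And>x. x \<in> set_pmf p \<Longrightarrow> x \<in> A \<Longrightarrow> measure_pmf.prob (f x) X \<le> r" "0 \<le> r"
  shows "measure_pmf.prob (bind_pmf p f) X \<le> measure_pmf.prob p (- A) + r"
proof -
  have "emeasure (measure_pmf (bind_pmf p f)) X = (\<integral>\<^sup>+x. emeasure (measure_pmf (f x)) X \<partial>measure_pmf p)"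
    by (rule emeasure_bind_pmf)
  also have "\<dots> \<le> (\<integral>\<^sup>+x. indicator (- A) x + ennreal r \<partial>measure_pmf p)"
  proof (rule nn_integral_mono_AE, rule AE_pmfI)
    fix x assume "x \<in> set_pmf p"
    then show "emeasure (measure_pmf (f x)) X \<le> indicator (- A) x + ennreal r"
      using assms by (cases "x \<in> A")
        (auto simp: measure_pmf.emeasure_eq_measure ennreal_leI intro: order_trans[OF _ add_increasing2])
  qed
  also have "\<dots> = emeasure (measure_pmf p) (- A) + ennreal r"
    by (simp add: nn_integral_add)
  also have "\<dots> = ennreal (measure_pmf.prob p (- A) + r)"
    using assms(2) by (simp add: measure_pmf.emeasure_eq_measure)
  finally show ?thesis
    unfolding measure_pmf.emeasure_eq_measure using assms(2) by (subst (asm) ennreal_le_iff) auto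
qed

text \<open>A collects the good degree sequences. Conditioning on an even sum enlarges the
  probability of its complement at most by the factor 1 / q.\<close>

lemma prob_random_multigraph_le:
  assumes n: "n \<in> admissible D" and q: "0 < q" "q \<le> measure_pmf.prob (iid_degrees D n) (even_sum n)"
    and le: "\<And>d. d \<in> A \<Longrightarrow> even (\<Sum>i=1..n. d i) \<Longrightarrow> measure_pmf.prob (configuration_model n d) X \<le> r" and r: "0 \<le> r"
  shows "measure_pmf.prob (random_multigraph D n) X \<le> measure_pmf.prob (iid_degrees D n) (- A) / q + r"
proof -
  let ?p = "iid_degrees D n"
  have "measure_pmf.prob ?p (even_sum n) > 0" using n by (simp add: admissible_def)
  then have ne: "set_pmf ?p \<inter> even_sum n \<noteq> {}"
    by (auto simp: measure_pmf_zero_iff[symmetric])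
  have "measure_pmf.prob (random_multigraph D n) X \<le> measure_pmf.prob (cond_pmf ?p (even_sum n)) (- A) + r"
    unfolding random_multigraph_def
    by (rule prob_bind_pmf_le) (use le r ne in \<open>auto simp: set_cond_pmf[OF ne] even_sum_def\<close>)
  also have "measure_pmf.prob (cond_pmf ?p (even_sum n)) (- A)
      = measure_pmf.prob ?p (even_sum n \<inter> - A) / measure_pmf.prob ?p (even_sum n)"
    unfolding cond_pmf.rep_eq[OF ne]
    by (rule measure_uniform_measure) (use \<open>measure_pmf.prob ?p (even_sum n) > 0\<close> in \<open>auto simp: measure_pmf.emeasure_eq_measure\<close>)
  also have "\<dots> \<le> measure_pmf.prob ?p (- A) / q"
    using q by (intro frac_le measure_pmf.finite_measure_mono) auto
  finally show ?thesis by simp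
qed

lemma prob_component_deviation_le:
  fixes e \<mu> u l p q :: real
  assumes even: "even (\<Sum>i=1..n. d i)"
    and above: "measure_pmf.prob (configuration_model n d) {G. u < card (largest_component G)} \<le> p"
    and below: "measure_pmf.prob (configuration_model n d) {G. card (largest_component G) < l} \<le> q"
    and u: "u \<le> real (Max (d ` {1..n})) / \<mu> + e" and l: "real (Max (d ` {1..n})) / \<mu> - e \<le> l"
  shows "measure_pmf.prob (configuration_model n d)
    {G. e < \<bar>real (card (largest_component G)) - real (max_degree G) / \<mu>\<bar>} \<le> p + q"
proof -
  let ?P = "configuration_model n d"
  let ?X = "{G. e < \<bar>real (card (largest_component G)) - real (max_degree G) / \<mu>\<bar>}"
  let ?U = "{G. u < card (largest_component G)}" and ?L = "{G. card (largest_component G) < l}"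
  have "?X \<inter> set_pmf ?P \<subseteq> ?U \<union> ?L"
  proof
    fix G assume G: "G \<in> ?X \<inter> set_pmf ?P"
    then have "max_degree G = Max (d ` {1..n})"
      using max_degree_multigraph_of_matching unfolding set_pmf_configuration_model[OF even] by auto
    then have "e < \<bar>real (card (largest_component G)) - real (Max (d ` {1..n})) / \<mu>\<bar>" using G by simp
    then show "G \<in> ?U \<union> ?L" using u l by (auto simp: abs_if split: if_splits)
  qed
  then have "measure_pmf.prob ?P (?X \<inter> set_pmf ?P) \<le> measure_pmf.prob ?P (?U \<union> ?L)"
    by (intro measure_pmf.finite_measure_mono) auto
  also have "\<dots> \<le> measure_pmf.prob ?P ?U + measure_pmf.prob ?P ?L"
    by (intro measure_Un_le) auto
  finally show ?thesis using above below by (simp add: measure_Int_set_pmf)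
qed

text \<open>Here \<rho> separates the two slopes from \<mu>. The upper error is at most e / 4 + e /
  8 + e / 8 + e / 4, due to \<rho>, x, their product and the rounding; the lower error is at most e
  / 4 + e / 8.\<close>

lemma component_size_window:
  fixes \<Delta> \<mu> \<rho> x e :: real
  assumes "0 < \<mu>" "0 \<le> \<rho>" "\<rho> \<le> 1" "0 \<le> \<Delta>" "0 \<le> x"
    and "\<Delta> * \<rho> / \<mu> \<le> e / 4" "x / \<mu> \<le> e / 8" "1 \<le> e / 4"
  shows "(\<Delta> + x) / (\<mu> / (1 + \<rho>)) + 1 \<le> \<Delta> / \<mu> + e"
    and "\<Delta> / \<mu> - e \<le> (\<Delta> - x) / (\<mu> * (1 + \<rho>))"
proof -
  have "x / \<mu> * \<rho> \<le> x / \<mu> * 1" using assms by (intro mult_left_mono) auto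
  moreover have "(\<Delta> + x) / (\<mu> / (1 + \<rho>)) = \<Delta> / \<mu> + \<Delta> * \<rho> / \<mu> + x / \<mu> + x / \<mu> * \<rho>"
    by (simp add: algebra_simps add_divide_distrib)
  ultimately show "(\<Delta> + x) / (\<mu> / (1 + \<rho>)) + 1 \<le> \<Delta> / \<mu> + e" using assms by linarith
  have "(1 - \<rho>) * (1 + \<rho>) \<le> 1" by (simp add: algebra_simps)
  then have "1 - \<rho> \<le> 1 / (1 + \<rho>)" using assms by (simp add: le_divide_eq)
  then have "\<Delta> / \<mu> * (1 - \<rho>) \<le> \<Delta> / \<mu> * (1 / (1 + \<rho>))" using assms by (intro mult_left_mono) auto
  moreover have "x / \<mu> * (1 / (1 + \<rho>)) \<le> x / \<mu> * 1" using assms by (intro mult_left_mono) auto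
  moreover have "(\<Delta> - x) / (\<mu> * (1 + \<rho>)) = \<Delta> / \<mu> * (1 / (1 + \<rho>)) - x / \<mu> * (1 / (1 + \<rho>))"
    by (simp add: diff_divide_distrib)
  moreover have "\<Delta> / \<mu> * (1 - \<rho>) = \<Delta> / \<mu> - \<Delta> * \<rho> / \<mu>" by (simp add: right_diff_distrib)
  ultimately show "\<Delta> / \<mu> - e \<le> (\<Delta> - x) / (\<mu> * (1 + \<rho>))" using assms by linarith
qed

lemma eventually_component_deviation_le:
  fixes \<gamma> \<epsilon> \<delta> :: real
  assumes \<gamma>: "\<gamma> > 3" and tail: "(\<lambda>k. measure_pmf.prob D {k..}) \<in> O(\<lambda>k. real k powr (1 - \<gamma>))"
    and nu: "nu D < 1" and ED: "measure_pmf.expectation D real > 0" and \<epsilon>: "\<epsilon> > 0" and \<delta>: "\<delta> > 0"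
  shows "eventually (\<lambda>n. n \<in> admissible D \<longrightarrow> measure_pmf.prob (random_multigraph D n)
    {G. \<epsilon> * real n powr (1 / (\<gamma> - 1))
      < \<bar>real (card (largest_component G)) - real (max_degree G) / (1 - nu D)\<bar>} \<le> \<delta>) sequentially"
proof -
  define \<alpha> where "\<alpha> = 1 / (\<gamma> - 1)"
  have \<alpha>: "0 < \<alpha>" "2 * \<alpha> < 1" using \<gamma> by (simp_all add: \<alpha>_def)
  define \<mu> where "\<mu> = 1 - nu D"
  \<comment> \<open>This gives \<mu> \<le> 1 and thereby \<kappa>U \<le> 1 and \<kappa>L \<le> 2, as
    the exploration and drift bounds demand.\<close>
  have "0 \<le> nu D" unfolding nu_def
  proof (intro divide_nonneg_nonneg Bochner_Integration.integral_nonneg)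
    fix k :: nat show "0 \<le> real k * (real k - 1)" by (cases k) auto
  qed auto
  then have \<mu>: "0 < \<mu>" "\<mu> \<le> 1" using nu by (simp_all add: \<mu>_def)
  note D2 = integrable_square_of_tail[OF \<gamma> tail]
  obtain q where q: "q > 0" "\<And>n. n \<in> admissible D \<Longrightarrow> q \<le> measure_pmf.prob (iid_degrees D n) (even_sum n)"
    by (rule prob_even_sum_bounded_below) blast
  obtain C0 where C0: "C0 > 0"
    "eventually (\<lambda>x::real. measure_pmf.prob D {k. x < real k} \<le> C0 * x powr (1 - \<gamma>)) at_top"
    by (rule tail_bound[OF \<gamma> tail])
  \<comment> \<open>Chosen so that the union bound n * C0 * (C * a n) powr (1 - \<gamma>) for a
    degree above C * a n equals \<delta> * q / 8.\<close>
  define C where "C = (\<delta> * q / (8 * C0)) powr (1 / (1 - \<gamma>))"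
  have C: "C > 0" "C powr (1 - \<gamma>) = \<delta> * q / (8 * C0)"
    using \<delta> q C0 \<gamma> by (simp_all add: C_def powr_powr)
  \<comment> \<open>Makes the error from changing the slope, at most C * a n * \<rho> / \<mu>, no
    larger than \<epsilon> * a n / 4.\<close>
  define \<rho> where "\<rho> = min 1 (\<epsilon> * \<mu> / (4 * C))"
  have \<rho>: "0 < \<rho>" "\<rho> \<le> 1" "C * \<rho> / \<mu> \<le> \<epsilon> / 4"
  proof -
    show "0 < \<rho>" "\<rho> \<le> 1" using \<epsilon> \<mu> C by (auto simp: \<rho>_def)
    have "C * \<rho> \<le> C * (\<epsilon> * \<mu> / (4 * C))" unfolding \<rho>_def using C by (intro mult_left_mono) auto
    then show "C * \<rho> / \<mu> \<le> \<epsilon> / 4" using C \<mu> by (simp add: divide_le_eq)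
  qed
  define \<kappa>U where "\<kappa>U = \<mu> / (1 + \<rho>)"
  define \<kappa>L where "\<kappa>L = \<mu> * (1 + \<rho>)"
  have \<kappa>U: "0 < \<kappa>U" "\<kappa>U < 1 - nu D" "\<kappa>U \<le> 1"
  proof -
    show "0 < \<kappa>U" using \<mu> \<rho> by (simp add: \<kappa>U_def)
    have "\<mu> < \<mu> * (1 + \<rho>)" using \<mu> \<rho> by simp
    then show "\<kappa>U < 1 - nu D" using \<rho> by (simp add: \<kappa>U_def \<mu>_def[symmetric] divide_less_eq)
    then show "\<kappa>U \<le> 1" using \<mu> by (simp add: \<mu>_def)
  qed
  have \<kappa>L: "0 < \<kappa>L" "1 - nu D < \<kappa>L" "\<kappa>L \<le> 2"
  proof -
    show "0 < \<kappa>L" "1 - nu D < \<kappa>L" using \<mu> \<rho> by (simp_all add: \<kappa>L_def \<mu>_def[symmetric])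
    have "\<kappa>L \<le> 1 * (1 + 1)" unfolding \<kappa>L_def using \<mu> \<rho> by (intro mult_mono) auto
    then show "\<kappa>L \<le> 2" by simp
  qed
  define cU where "cU = measure_pmf.expectation D real * (1 - nu D - \<kappa>U) / 2"
  define cL where "cL = measure_pmf.expectation D real * (\<kappa>L - (1 - nu D)) / 2"
  have c: "cU > 0" "cL > 0" using ED \<kappa>U \<kappa>L by (simp_all add: cU_def cL_def)
  define a where "a n = real n powr \<alpha>" for n
  \<comment> \<open>A logarithm kept at least 1 for every n, including n = 0.\<close>
  define L where "L n = 1 + ln (1 + real n)" for n
  \<comment> \<open>The cut-off 1 / \<theta>U is below a by a factor of about
    \<open>(L n)\<^sup>2\<close>, so that \<theta>U * x grows like \<open>(L n)\<^sup>2\<close> and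
    beats the ln n of the union bound. The 2 ensures \<theta>U \<le> 1 / 2.\<close>
  define \<theta>U where "\<theta>U n = 1 / (2 + a n / (L n)\<^sup>2)" for n
  \<comment> \<open>There is no union bound here: \<theta>L * x only has to diverge, while \<theta>L
    * n must dominate the square of a.\<close>
  define \<theta>L where "\<theta>L n = 1 / (1 + L n)" for n
  \<comment> \<open>The expected number of big vertices is O(L^(2 * \<gamma> - 2)); the larger
    exponent lets Markov's inequality give a probability tending to 0.\<close>
  define J where "J n = L n powr (2 * \<gamma>)" for n
  \<comment> \<open>Makes x n / \<mu> equal to \<epsilon> * a n / 8, as
    \<open>component_size_window\<close> asks.\<close>
  define e where "e = \<epsilon> * \<mu> / 8"
  have e: "e > 0" using \<epsilon> \<mu> by (simp add: e_def)
  define x where "x n = e * a n" for n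
  have L1: "L n \<ge> 1" for n by (simp add: L_def)
  have a0: "a n \<ge> 0" for n by (simp add: a_def)
  have b2: "2 + a n / (L n)\<^sup>2 \<ge> 2" for n using a0 by simp
  have \<theta>U: "0 < \<theta>U n" "\<theta>U n \<le> 1 / 2" for n
    unfolding \<theta>U_def using b2[of n] by (auto intro!: divide_left_mono)
  have \<theta>L: "0 < \<theta>L n" "\<theta>L n \<le> 1 / 2" for n
    unfolding \<theta>L_def using L1[of n] by (auto intro!: divide_left_mono)
  have \<theta>U0: "\<theta>U \<longlonglongrightarrow> 0" "(\<lambda>n. (1 / \<theta>U n)\<^sup>2 / n) \<longlonglongrightarrow> 0"
    unfolding \<theta>U_def[abs_def] a_def L_def using \<alpha> by (simp_all) real_asymp+
  have \<theta>L0: "\<theta>L \<longlonglongrightarrow> 0" "(\<lambda>n. (1 / \<theta>L n)\<^sup>2 / n) \<longlonglongrightarrow> 0"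
    unfolding \<theta>L_def[abs_def] L_def by (simp_all) real_asymp+
  \<comment> \<open>The exceptional degree sequences: a degree is too large, one of the two drifts
    fails, or there are too many big vertices.\<close>
  define bad1 where "bad1 n = {d :: nat \<Rightarrow> nat. \<exists>i\<in>{1..n}. d i \<in> {k. C * a n < real k}}" for n
  define bad2 where "bad2 n = {d :: nat \<Rightarrow> nat. \<not> (\<Sum>i | i \<in> {1..n} \<and> \<theta>U n * d i \<le> 1.
      d i * (exp (\<theta>U n * (real (d i) - 2 + \<kappa>U)) - 1)) \<le> - cU * \<theta>U n * n}" for n
  define bad3 where "bad3 n = {d :: nat \<Rightarrow> nat. \<not> cL * \<theta>L n * n \<le> (\<Sum>i=1..n.
      d i * (1 - exp (- \<theta>L n * (real (d i) - 2 + \<kappa>L))))}" for n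
  define bad4 where "bad4 n = {d :: nat \<Rightarrow> nat. J n \<le> real (card {i\<in>{1..n}. d i \<in> {k. 1 / \<theta>U n < real k}})}" for n
  let ?pr = "\<lambda>n. measure_pmf.prob (iid_degrees D n)"
  have a_top: "filterlim a at_top sequentially" unfolding a_def[abs_def] using \<alpha> by real_asymp
  have \<alpha>\<gamma>: "\<alpha> * (1 - \<gamma>) = - 1" using \<gamma> by (simp add: \<alpha>_def field_simps)
  have a_pow: "a n powr (1 - \<gamma>) = 1 / n" for n
    unfolding a_def powr_powr \<alpha>\<gamma> by (cases "n = 0") (auto simp: powr_minus divide_inverse)
  have bad1: "eventually (\<lambda>n. ?pr n (bad1 n) \<le> \<delta> * q / 8) sequentially"
  proof -
    have "filterlim (\<lambda>n. C * a n) at_top sequentially"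
      by (rule filterlim_tendsto_pos_mult_at_top[OF tendsto_const C(1) a_top])
    from eventually_compose_filterlim[OF C0(2) this] eventually_gt_at_top[of 0] show ?thesis
    proof eventually_elim
      case (elim n)
      have "?pr n (bad1 n) \<le> n * measure_pmf.prob D {k. C * a n < real k}"
        unfolding bad1_def by (rule prob_iid_degrees_max_le)
      also have "\<dots> \<le> n * (C0 * (C * a n) powr (1 - \<gamma>))" using elim by (intro mult_left_mono) auto
      also have "\<dots> = \<delta> * q / 8" using elim C C0 a0[of n] by (simp add: powr_mult a_pow)
      finally show ?case .
    qed
  qed
  have bad2: "(\<lambda>n. ?pr n (bad2 n)) \<longlonglongrightarrow> 0"
    unfolding bad2_def cU_def
    by (rule prob_truncated_drift_tendsto[OF D2 ED _ _ _ \<theta>U \<theta>U0]) (use \<kappa>U in auto)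
  have bad3: "(\<lambda>n. ?pr n (bad3 n)) \<longlonglongrightarrow> 0"
    unfolding bad3_def cL_def
    by (rule prob_reverse_drift_tendsto[OF D2 ED _ _ _ \<theta>L \<theta>L0]) (use \<kappa>L in auto)
  have bad4: "(\<lambda>n. ?pr n (bad4 n)) \<longlonglongrightarrow> 0"
  proof (rule tendsto_sandwich[OF _ _ tendsto_const])
    show "eventually (\<lambda>n. 0 \<le> ?pr n (bad4 n)) sequentially" by simp
    have "filterlim (\<lambda>n. 1 / \<theta>U n) at_top sequentially"
      unfolding \<theta>U_def a_def L_def using \<alpha> by simp real_asymp
    from eventually_compose_filterlim[OF C0(2) this] eventually_gt_at_top[of 0]
    show "eventually (\<lambda>n. ?pr n (bad4 n) \<le> C0 / (L n)\<^sup>2) sequentially"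
    proof eventually_elim
      case (elim n)
      have apos: "a n > 0" using elim by (simp add: a_def)
      have Lpos: "L n > 0" using L1[of n] by simp
      have L2: "(L n)\<^sup>2 = L n powr 2" using powr_realpow[OF Lpos, of 2] by simp
      \<comment> \<open>Dropping the 2 from 1 / \<theta>U raises the power, since its exponent is
        negative.\<close>
      have "(1 / \<theta>U n) powr (1 - \<gamma>) \<le> (a n / (L n)\<^sup>2) powr (1 - \<gamma>)"
        using \<gamma> apos Lpos by (intro powr_mono2') (auto simp: \<theta>U_def)
      also have "\<dots> = (1 / n) * L n powr (2 * \<gamma> - 2)"
      proof -
        have "((L n)\<^sup>2) powr (1 - \<gamma>) = L n powr (2 * (1 - \<gamma>))"
          by (simp only: L2 powr_powr)
        moreover have "2 * \<gamma> - 2 = - (2 * (1 - \<gamma>))" by simp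
        moreover have "(a n / (L n)\<^sup>2) powr (1 - \<gamma>) = a n powr (1 - \<gamma>) / (L n)\<^sup>2 powr (1 - \<gamma>)"
          by (rule powr_divide)
        ultimately show ?thesis by (simp only: a_pow powr_minus_divide times_divide_eq_right mult_1_right)
      qed
      finally have "measure_pmf.prob D {k. 1 / \<theta>U n < real k} \<le> C0 * ((1 / n) * L n powr (2 * \<gamma> - 2))"
        using elim C0(1) by (meson mult_left_mono less_imp_le order_trans)
      then have "n * measure_pmf.prob D {k. 1 / \<theta>U n < real k} \<le> n * (C0 * ((1 / n) * L n powr (2 * \<gamma> - 2)))"
        by (rule mult_left_mono) simp
      then have le: "n * measure_pmf.prob D {k. 1 / \<theta>U n < real k} \<le> C0 * L n powr (2 * \<gamma> - 2)"
        using elim by simp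
      have "?pr n (bad4 n) \<le> n * measure_pmf.prob D {k. 1 / \<theta>U n < real k} / J n"
        unfolding bad4_def by (rule prob_iid_degrees_count_le) (use Lpos in \<open>simp add: J_def\<close>)
      also have "\<dots> \<le> C0 * L n powr (2 * \<gamma> - 2) / J n"
        using le by (rule divide_right_mono) (simp add: J_def)
      also have "\<dots> = C0 / (L n)\<^sup>2"
        unfolding L2 J_def powr_diff using Lpos by simp
      finally show ?case .
    qed
    show "(\<lambda>n. C0 / (L n)\<^sup>2) \<longlonglongrightarrow> 0" unfolding L_def by real_asymp
  qed
  have small: "eventually (\<lambda>n. ?pr n (bad2 n) < \<delta> * q / 8) sequentially"
    "eventually (\<lambda>n. ?pr n (bad3 n) < \<delta> * q / 8) sequentially"
    "eventually (\<lambda>n. ?pr n (bad4 n) < \<delta> * q / 8) sequentially"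
    using bad2 bad3 bad4 \<delta> q(1) by (auto intro!: order_tendstoD(2)[where y = 0])
  \<comment> \<open>Failure probability for good degrees. The middle term tends to 0 because a^2 has
    order n^(2 * \<alpha>) with 2 * \<alpha> < 1 and J is polylogarithmic.\<close>
  define r where "r n = (2 * real n * exp (- \<theta>U n * x n) + 2 * ((C * a n) * J n)\<^sup>2 / (cU * n))
    + exp (- \<theta>L n * x n)" for n
  have "(\<lambda>n. r n) \<longlonglongrightarrow> (2 * 0 + 2 * C\<^sup>2 / cU * 0) + 0"
  proof -
    have "(\<lambda>n. real n * exp (- \<theta>U n * x n)) \<longlonglongrightarrow> 0"
      unfolding \<theta>U_def x_def a_def L_def using \<alpha> e by real_asymp
    moreover have "(\<lambda>n. (a n * J n)\<^sup>2 / n) \<longlonglongrightarrow> 0"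
      unfolding a_def J_def L_def using \<alpha> \<gamma> by real_asymp
    moreover have "(\<lambda>n. exp (- \<theta>L n * x n)) \<longlonglongrightarrow> 0"
      unfolding \<theta>L_def x_def a_def L_def using \<alpha> e by real_asymp
    ultimately have "(\<lambda>n. (2 * (real n * exp (- \<theta>U n * x n)) + 2 * C\<^sup>2 / cU * ((a n * J n)\<^sup>2 / n))
        + exp (- \<theta>L n * x n)) \<longlonglongrightarrow> (2 * 0 + 2 * C\<^sup>2 / cU * 0) + 0"
      by (intro tendsto_add tendsto_mult tendsto_const)
    moreover have "r n = (2 * (real n * exp (- \<theta>U n * x n)) + 2 * C\<^sup>2 / cU * ((a n * J n)\<^sup>2 / n))
        + exp (- \<theta>L n * x n)" for n
      by (simp add: r_def power_mult_distrib mult_ac)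
    ultimately show ?thesis by simp
  qed
  then have r_small: "eventually (\<lambda>n. r n < \<delta> / 2) sequentially"
    using \<delta> by (intro order_tendstoD) auto
  have budgetU: "eventually (\<lambda>n. (C * a n + x n) / \<kappa>U + 2 \<le> cU * n / 2) sequentially"
  proof -
    define K where "K = (C + e) / \<kappa>U"
    have "(\<lambda>n. a n / n) \<longlonglongrightarrow> 0" unfolding a_def using \<alpha> by real_asymp
    moreover have "(\<lambda>n. 1 / real n) \<longlonglongrightarrow> 0" by real_asymp
    ultimately have "(\<lambda>n. K * (a n / n) + 2 * (1 / real n)) \<longlonglongrightarrow> K * 0 + 2 * 0"
      by (intro tendsto_add tendsto_mult tendsto_const)
    then have "eventually (\<lambda>n. K * (a n / n) + 2 * (1 / real n) < cU / 2) sequentially"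
      using c by (intro order_tendstoD) auto
    then show ?thesis using eventually_gt_at_top[of 0]
    proof eventually_elim
      case (elim n)
      have "(K * a n + 2) / n < cU / 2" using elim(1) by (simp add: add_divide_distrib)
      then have "K * a n + 2 < cU / 2 * n" using elim(2) by (simp add: divide_less_eq)
      moreover have "(C * a n + x n) / \<kappa>U = K * a n" by (simp add: K_def x_def algebra_simps)
      ultimately show ?case by simp
    qed
  qed
  have budgetL: "eventually (\<lambda>n. 8 * (C * a n + C * a n / \<kappa>L * (C * a n)) + (C * a n / \<kappa>L + 1) * (C * a n)
      \<le> cL * \<theta>L n * n) sequentially"
  proof -
    define K where "K = 9 * C + 9 * C\<^sup>2 / \<kappa>L"
    have "(\<lambda>n. (a n)\<^sup>2 * (1 + L n) / n) \<longlonglongrightarrow> 0"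
      unfolding a_def L_def using \<alpha> by real_asymp
    then have "(\<lambda>n. K * ((a n)\<^sup>2 * (1 + L n) / n)) \<longlonglongrightarrow> 0" by (rule tendsto_mult_right_zero)
    then have "eventually (\<lambda>n. K * ((a n)\<^sup>2 * (1 + L n) / n) < cL) sequentially"
      using c by (intro order_tendstoD) auto
    moreover have "eventually (\<lambda>n. 1 \<le> a n) sequentially"
      using a_top by (simp add: filterlim_at_top)
    ultimately show ?thesis using eventually_gt_at_top[of 0]
    proof eventually_elim
      case (elim n)
      have "8 * (C * a n + C * a n / \<kappa>L * (C * a n)) + (C * a n / \<kappa>L + 1) * (C * a n)
          = 9 * C * a n + 9 * C\<^sup>2 / \<kappa>L * (a n)\<^sup>2"
        by (simp add: power2_eq_square algebra_simps add_divide_distrib)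
      also have "a n * 1 \<le> a n * a n" using elim by (intro mult_left_mono) auto
      then have "9 * C * a n \<le> 9 * C * (a n)\<^sup>2" using C by (simp add: power2_eq_square)
      then have "9 * C * a n + 9 * C\<^sup>2 / \<kappa>L * (a n)\<^sup>2 \<le> K * (a n)\<^sup>2" by (simp add: K_def algebra_simps)
      also have "\<dots> \<le> cL * \<theta>L n * n"
      proof -
        have "K * (a n)\<^sup>2 * (1 + L n) \<le> cL * n" using elim by (simp add: divide_less_eq)
        then show ?thesis using L1[of n] by (simp add: \<theta>L_def le_divide_eq)
      qed
      finally show ?case .
    qed
  qed
  have window: "eventually (\<lambda>n. 1 \<le> \<epsilon> * a n / 4) sequentially"
    using \<epsilon> a_top by (auto simp: filterlim_at_top elim!: allE[of _ "4 / \<epsilon>"] eventually_mono simp: divide_le_eq mult.commute)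
  show ?thesis
    using bad1 small r_small budgetU budgetL window eventually_gt_at_top[of 0]
  proof eventually_elim
    case (elim n)
    let ?X = "{G. \<epsilon> * a n < \<bar>real (card (largest_component G)) - real (max_degree G) / \<mu>\<bar>}"
    have x0: "0 \<le> x n" using e a0 by (simp add: x_def)
    have cfg: "measure_pmf.prob (configuration_model n d) ?X \<le> r n"
      if d: "d \<in> - (bad1 n \<union> bad2 n \<union> bad3 n \<union> bad4 n)" and even: "even (\<Sum>i=1..n. d i)" for d
    proof -
      define S where "S = {i \<in> {1..n}. \<theta>U n * d i \<le> 1}"
      have dC: "real (d i) \<le> C * a n" if "i \<in> {1..n}" for i
        using d that by (auto simp: bad1_def not_less)
      have "Max (d ` {1..n}) \<in> d ` {1..n}" using elim by (intro Max_in) auto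
      then have \<Delta>: "real (Max (d ` {1..n})) \<le> C * a n" using dC by auto
      have compl: "{1..n} - S = {i\<in>{1..n}. d i \<in> {k. 1 / \<theta>U n < real k}}"
        using \<theta>U(1)[of n] by (auto simp: S_def divide_less_eq mult.commute)
      have "1 \<le> n" using elim by simp
      have window': "(real (Max (d ` {1..n})) + x n) / \<kappa>U + 1 \<le> real (Max (d ` {1..n})) / \<mu> + \<epsilon> * a n"
        "real (Max (d ` {1..n})) / \<mu> - \<epsilon> * a n \<le> (real (Max (d ` {1..n})) - x n) / \<kappa>L"
      proof -
        have "real (Max (d ` {1..n})) * (\<rho> / \<mu>) \<le> C * a n * (\<rho> / \<mu>)"
          using \<Delta> \<rho> \<mu> by (intro mult_right_mono) auto
        also have "\<dots> = C * \<rho> / \<mu> * a n" by simp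
        also have "\<dots> \<le> \<epsilon> / 4 * a n" using \<rho>(3) a0 by (rule mult_right_mono)
        finally have w1: "real (Max (d ` {1..n})) * \<rho> / \<mu> \<le> \<epsilon> * a n / 4" by simp
        have w2: "x n / \<mu> \<le> \<epsilon> * a n / 8" using \<mu> by (simp add: x_def e_def)
        have w3: "1 \<le> \<epsilon> * a n / 4" using elim by simp
        note w = component_size_window[OF \<mu>(1) less_imp_le[OF \<rho>(1)] \<rho>(2) of_nat_0_le_iff x0 w1 w2 w3]
        show "(real (Max (d ` {1..n})) + x n) / \<kappa>U + 1 \<le> real (Max (d ` {1..n})) / \<mu> + \<epsilon> * a n"
          "real (Max (d ` {1..n})) / \<mu> - \<epsilon> * a n \<le> (real (Max (d ` {1..n})) - x n) / \<kappa>L"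
          unfolding \<kappa>U_def \<kappa>L_def by (rule w)+
      qed
      have "measure_pmf.prob (configuration_model n d)
          {G. (real (Max (d ` {1..n})) + x n) / \<kappa>U + 1 < card (largest_component G)}
          \<le> 2 * real n * exp (- \<theta>U n * x n) + 2 * ((C * a n) * J n)\<^sup>2 / (cU * n)"
      proof (rule prob_largest_component_gt_le[OF \<open>1 \<le> n\<close> even \<theta>U(1) \<kappa>U(1,3) c(1) _ dC _ _ x0])
        show "S \<subseteq> {1..n}" by (auto simp: S_def)
        show "(\<Sum>i\<in>S. d i * (exp (\<theta>U n * (real (d i) - 2 + \<kappa>U)) - 1)) \<le> - cU * \<theta>U n * n"
          using d by (simp add: bad2_def S_def)
        show "card ({1..n} - S) \<le> J n" unfolding compl using d by (simp add: bad4_def)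
      qed (use elim in auto)
      moreover have "measure_pmf.prob (configuration_model n d)
          {G. card (largest_component G) < (real (Max (d ` {1..n})) - x n) / \<kappa>L} \<le> exp (- \<theta>L n * x n)"
      proof (rule prob_largest_component_less_le[OF \<open>1 \<le> n\<close> even \<theta>L(1) _ \<kappa>L(1) dC x0])
        show "\<theta>L n \<le> 1" using \<theta>L(2)[of n] by simp
        have "cL * \<theta>L n * n \<le> (\<Sum>i\<in>{1..n}. d i * (1 - exp (- \<theta>L n * (real (d i) - 2 + \<kappa>L))))"
          using d by (simp add: bad3_def)
        then show "8 * (C * a n + C * a n / \<kappa>L * (C * a n)) + (C * a n / \<kappa>L + 1) * (C * a n)
          \<le> (\<Sum>i\<in>{1..n}. d i * (1 - exp (- \<theta>L n * (real (d i) - 2 + \<kappa>L))))"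
          using elim by linarith
      qed
      ultimately show ?thesis
        unfolding r_def by (rule prob_component_deviation_le[OF even _ _ window'])
    qed
    \<comment> \<open>Four events of probability at most \<delta> * q / 8: after division by q they
      use half of \<delta>, and r n takes less than the other half.\<close>
    have "?pr n (bad1 n \<union> bad2 n \<union> bad3 n \<union> bad4 n)
        \<le> ?pr n (bad1 n) + ?pr n (bad2 n) + ?pr n (bad3 n) + ?pr n (bad4 n)"
      by (intro order_trans[OF measure_Un_le] add_mono order_refl) auto
    also have "\<dots> \<le> \<delta> * q / 2" using elim by linarith
    finally have bad: "?pr n (bad1 n \<union> bad2 n \<union> bad3 n \<union> bad4 n) / q \<le> \<delta> / 2"
      using q(1) by (simp add: divide_le_eq)
    have r0: "0 \<le> r n" using c by (simp add: r_def)
    have "measure_pmf.prob (random_multigraph D n) ?X \<le> \<delta>" if "n \<in> admissible D"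
    proof -
      have "measure_pmf.prob (random_multigraph D n) ?X
          \<le> ?pr n (- (- (bad1 n \<union> bad2 n \<union> bad3 n \<union> bad4 n))) / q + r n"
        by (rule prob_random_multigraph_le[OF that q(1) q(2)[OF that] cfg r0])
      also have "\<dots> \<le> \<delta>" unfolding double_complement using bad elim by linarith
      finally show ?thesis .
    qed
    then show ?case by (simp add: a_def \<alpha>_def \<mu>_def)
  qed
qed

section \<open>The case D = 0 almost surely, and the conclusion\<close>

lemma random_multigraph_degenerate:
  assumes "measure_pmf.expectation D real = 0" "integrable (measure_pmf D) real" "n \<ge> 1"
    "n \<in> admissible D" "G \<in> set_pmf (random_multigraph D n)"
  shows "card (largest_component G) = 1" "max_degree G = 0"
proof -
  have "AE k in measure_pmf D. real k = 0"
    using integral_nonneg_eq_0_iff_AE[OF assms(2)] assms(1) by simp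
  then have D0: "set_pmf D \<subseteq> {0}" by (auto simp: AE_measure_pmf_iff)
  have "set_pmf (iid_degrees D n) \<inter> even_sum n \<noteq> {}"
    using assms(4) by (auto simp: admissible_def measure_pmf_zero_iff[symmetric])
  then obtain d where d: "d \<in> set_pmf (iid_degrees D n)" "d \<in> even_sum n" "G \<in> set_pmf (configuration_model n d)"
    using assms(5) by (auto simp: random_multigraph_def)
  have d0: "d i = 0" if "i \<in> {1..n}" for i
  proof -
    have "d i \<in> set_pmf (map_pmf (\<lambda>d. d i) (iid_degrees D n))" using d(1) by simp
    then show ?thesis using D0 unfolding map_pmf_iid_degrees[OF that] by blast
  qed
  obtain M where M: "M \<in> perfect_matchings (half_edges n d)" "G = multigraph_of_matching n M"
    using d(2,3) set_pmf_configuration_model[of d n] by (auto simp: even_sum_def)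
  have "component_of n M v = {v}" if "v \<in> {1..n}" for v
  proof -
    have "stubs d {v} = {}" using d0[OF that] by (auto simp: mem_stubs)
    then have "closed_under M (stubs d {v})" by (simp add: closed_under_def)
    then have "component_of n M v \<subseteq> {v}" using component_of_subset_closed[OF M(1)] by simp
    then show ?thesis using mem_component_of[OF that] by blast
  qed
  then have "(\<lambda>v. card (component_of n M v)) ` {1..n} = {1}" using assms(3) by force
  then show "card (largest_component G) = 1"
    unfolding M(2) card_largest_component_multigraph_of_matching[OF assms(3)] by simp
  have "d ` {1..n} = {0}" using d0 assms(3) by force
  then show "max_degree G = 0"
    unfolding M(2) max_degree_multigraph_of_matching[OF M(1)] by simp
qed

theorem corollary4p2:
  fixes D :: "nat pmf" and \<gamma> :: real
  assumes "\<gamma> > 3"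
    and "(\<lambda>k. measure_pmf.prob D {k..}) \<in> O(\<lambda>k. real k powr (1 - \<gamma>))"
    and "nu D < 1"
  shows "small_o_p (admissible D) (random_multigraph D)
           (\<lambda>n G. real (card (largest_component G)) - real (max_degree G) / (1 - nu D))
           (\<lambda>n. real n powr (1 / (\<gamma> - 1)))"
  unfolding small_o_p_def
proof (intro allI impI)
  fix \<epsilon> :: real assume \<epsilon>: "\<epsilon> > 0"
  let ?X = "\<lambda>n. {G. \<epsilon> * real n powr (1 / (\<gamma> - 1))
      < \<bar>real (card (largest_component G)) - real (max_degree G) / (1 - nu D)\<bar>}"
  have int: "integrable (measure_pmf D) real"
    using measure_pmf.square_integrable_imp_integrable[of real] integrable_square_of_tail[OF assms(1,2)] by simp
  have ev: "eventually (\<lambda>n. n \<in> admissible D \<longrightarrow> measure_pmf.prob (random_multigraph D n) (?X n) \<le> \<delta>) sequentially"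
    if "\<delta> > 0" for \<delta>
  proof (cases "measure_pmf.expectation D real = 0")
    case True
    define \<alpha> where "\<alpha> = 1 / (\<gamma> - 1)"
    have "0 < \<alpha>" using assms(1) by (simp add: \<alpha>_def)
    then have "filterlim (\<lambda>n. real n powr \<alpha>) at_top sequentially" by real_asymp
    then have "eventually (\<lambda>n. 1 / \<epsilon> \<le> real n powr \<alpha>) sequentially" by (simp add: filterlim_at_top)
    then show ?thesis using eventually_ge_at_top[of 1]
    proof eventually_elim
      case (elim n)
      \<comment> \<open>All components are single vertices and the maximum degree is 0, so the
        deviation equals 1 and does not exceed this threshold.\<close>
      have "1 \<le> \<epsilon> * real n powr \<alpha>" using elim \<epsilon> by (simp add: divide_le_eq mult.commute)
      then have "?X n \<inter> set_pmf (random_multigraph D n) = {}" if "n \<in> admissible D"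
        using random_multigraph_degenerate[OF True int elim(2) that] by (auto simp: \<alpha>_def)
      then have "measure_pmf.prob (random_multigraph D n) (?X n) = 0" if "n \<in> admissible D"
        using that measure_Int_set_pmf[of "random_multigraph D n" "?X n"] by simp
      then show ?case using \<open>\<delta> > 0\<close> by simp
    qed
  next
    case False
    moreover have "0 \<le> measure_pmf.expectation D real" by simp
    ultimately show ?thesis
      using eventually_component_deviation_le[OF assms _ \<epsilon> \<open>\<delta> > 0\<close>] by linarith
  qed
  show "((\<lambda>n. measure_pmf.prob (random_multigraph D n) (?X n)) \<longlongrightarrow> 0) (inf sequentially (principal (admissible D)))"
    unfolding tendsto_iff eventually_inf_principal
  proof (intro allI impI)
    fix \<delta> :: real assume "\<delta> > 0"
    then have "eventually (\<lambda>n. n \<in> admissible D \<longrightarrow> measure_pmf.prob (random_multigraph D n) (?X n) \<le> \<delta> / 2) sequentially"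
      by (intro ev) simp
    then show "eventually (\<lambda>n. n \<in> admissible D \<longrightarrow> dist (measure_pmf.prob (random_multigraph D n) (?X n)) 0 < \<delta>) sequentially"
      by eventually_elim (use \<open>\<delta> > 0\<close> in auto)
  qed
qed

end
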